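(* Let $\rho$ be an irreducible congruence representation of $\Gamma_\theta$ of dimension $d$ that is not extendable to $\mathrm{SL}_2(\mathbb{Z})$. Then either the induced representation $\mathrm{Ind}_{\Gamma_\theta}^{\mathrm{SL}_2(\mathbb{Z})}\rho$ is an irreducible representation of $\mathrm{SL}_2(\mathbb{Z})$ (of dimension $3d$), or it decomposes as the direct sum of two irreducible representations of $\mathrm{SL}_2(\mathbb{Z})$, each of dimension $\tfrac32 d$. In particular, if $d$ is odd, the second possibility does not occur.
   Context: Representations are finite-dimensional and complex. $\Gamma_\theta$ is the subgroup of $\mathrm{SL}_2(\mathbb{Z})$ generated by $s=\begin{pmatrix}0&-1\\1&0\end{pmatrix}$ and $t^2=\begin{pmatrix}1&2\\0&1\end{pmatrix}$; it has index 3 in $\mathrm{SL}_2(\mathbb{Z})$ and contains $\Gamma(2)$. $\Gamma(n)$ is the principal congruence subgroup of level $n$, i.e. the kernel of $\mathrm{SL}_2(\mathbb{Z})\to\mathrm{SL}_2(\mathbb{Z}/n)$. A representation of $\Gamma_\theta$ is called congruence if its kernel contains $\Gamma(n)$ for some positive integer $n$ (one may take $n$ even, and then $\rho$ factors through the finite group $\Gamma_\theta/\Gamma(n)$; induction to $\mathrm{SL}_2(\mathbb{Z})$ is understood as induction from $\Gamma_\theta/\Gamma(n)$ to $\mathrm{SL}_2(\mathbb{Z}/n)$). An irreducible representation $\rho$ of $\Gamma_\theta$ is called extendable if it is the restriction to $\Gamma_\theta$ of a (necessarily irreducible, congruence) representation of $\mathrm{SL}_2(\mathbb{Z})$ of the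 same dimension. *)

theory Defs
  imports
    "HOL-Analysis.Determinants"
    "HOL-Algebra.Generated_Groups"
    "HOL-Library.Function_Algebras"
    "HOL-Number_Theory.Cong"
begin

section \<open>The modular group, the theta group and the principal congruence subgroups\<close>

definition SL2Z :: "(int^2^2) monoid" where
  "SL2Z = \<lparr>carrier = {A. det A = 1}, monoid.mult = (**), one = mat 1\<rparr>"

definition mat_s :: "int^2^2" where
  "mat_s = vector [vector [0, -1], vector [1, 0]]"

definition mat_t_sq :: "int^2^2" where
  "mat_t_sq = vector [vector [1, 2], vector [0, 1]]"

definition Gamma_theta :: "(int^2^2) set" where
  "Gamma_theta = generate SL2Z {mat_s, mat_t_sq}"

text \<open>The kernel of reduction modulo \<open>n\<close>, written out entrywise.\<close>

definition Gamma :: "nat \<Rightarrow> (int^2^2) set" where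
  "Gamma n = {A \<in> carrier SL2Z. \<forall>i j. [A $ i $ j = mat 1 $ i $ j] (mod int n)}"

lemma group_SL2Z: "group SL2Z"
proof (rule groupI)
  fix A assume A: "A \<in> carrier SL2Z"
  define B :: "int^2^2" where
    "B = vector [vector [A$2$2, - (A$1$2)], vector [- (A$2$1), A$1$1]]"
  have "det B = 1" and "B ** A = mat 1"
    using A by (simp_all add: B_def SL2Z_def det_2 vec_eq_iff forall_2 matrix_matrix_mult_def
        sum_2 mat_def algebra_simps)
  then show "\<exists>B\<in>carrier SL2Z. B \<otimes>\<^bsub>SL2Z\<^esub> A = \<one>\<^bsub>SL2Z\<^esub>"
    by (auto simp: SL2Z_def)
qed (auto simp: SL2Z_def det_mul matrix_mul_assoc)

lemma subgroup_Gamma_theta: "subgroup Gamma_theta SL2Z"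
  unfolding Gamma_theta_def
  by (rule group.generate_is_subgroup[OF group_SL2Z])
    (simp add: SL2Z_def mat_s_def mat_t_sq_def det_2)

section \<open>Finite-dimensional complex representations\<close>

text \<open>
  The representation space is a subspace \<open>V\<close> of a complex vector space, given by an additive
  type and a scalar multiplication; the values of \<open>\<rho> g v\<close> for \<open>g \<notin> carrier G\<close> or \<open>v \<notin> V\<close> are
  irrelevant.  Each \<open>\<rho> g\<close> is invertible on \<open>V\<close> because \<open>G\<close> is a group.
\<close>

locale fd_rep = vector_space smul + group G
  for smul :: "complex \<Rightarrow> 'v::ab_group_add \<Rightarrow> 'v" and G :: "('g, 'b) monoid_scheme" (structure) +
  fixes V :: "'v set" and \<rho> :: "'g \<Rightarrow> 'v \<Rightarrow> 'v"
  assumes subspace_V: "subspace V"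
    and finite_dim_V: "\<exists>B. finite B \<and> span B = V"
    and act_closed: "\<lbrakk>g \<in> carrier G; v \<in> V\<rbrakk> \<Longrightarrow> \<rho> g v \<in> V"
    and act_add: "\<lbrakk>g \<in> carrier G; v \<in> V; w \<in> V\<rbrakk> \<Longrightarrow> \<rho> g (v + w) = \<rho> g v + \<rho> g w"
    and act_scale: "\<lbrakk>g \<in> carrier G; v \<in> V\<rbrakk> \<Longrightarrow> \<rho> g (smul c v) = smul c (\<rho> g v)"
    and act_one: "v \<in> V \<Longrightarrow> \<rho> \<one> v = v"
    and act_mult: "\<lbrakk>g \<in> carrier G; h \<in> carrier G; v \<in> V\<rbrakk> \<Longrightarrow> \<rho> (g \<otimes> h) v = \<rho> g (\<rho> h v)"

definition irreducible_rep ::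
    "(complex \<Rightarrow> 'v::ab_group_add \<Rightarrow> 'v) \<Rightarrow> ('g, 'b) monoid_scheme \<Rightarrow> 'v set \<Rightarrow> ('g \<Rightarrow> 'v \<Rightarrow> 'v) \<Rightarrow> bool"
  where "irreducible_rep smul G V \<rho> \<longleftrightarrow>
    fd_rep smul G V \<rho> \<and> V \<noteq> {0} \<and>
    (\<forall>W. module.subspace smul W \<and> W \<subseteq> V \<and> (\<forall>g\<in>carrier G. \<forall>w\<in>W. \<rho> g w \<in> W)
      \<longrightarrow> W = {0} \<or> W = V)"

definition internal_direct_sum :: "'v::ab_group_add set \<Rightarrow> 'v set \<Rightarrow> 'v set \<Rightarrow> bool" where
  "internal_direct_sum V W1 W2 \<longleftrightarrow> V = {w1 + w2 | w1 w2. w1 \<in> W1 \<and> w2 \<in> W2} \<and> W1 \<inter> W2 = {0}"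

definition sum_of_two_irreducibles ::
    "(complex \<Rightarrow> 'v::ab_group_add \<Rightarrow> 'v) \<Rightarrow> ('g, 'b) monoid_scheme \<Rightarrow> 'v set \<Rightarrow> ('g \<Rightarrow> 'v \<Rightarrow> 'v) \<Rightarrow> real \<Rightarrow> bool"
  where "sum_of_two_irreducibles smul G V \<rho> m \<longleftrightarrow>
    (\<exists>W1 W2. internal_direct_sum V W1 W2 \<and>
      irreducible_rep smul G W1 \<rho> \<and> real (vector_space.dim smul W1) = m \<and>
      irreducible_rep smul G W2 \<rho> \<and> real (vector_space.dim smul W2) = m)"

definition rep_kernel :: "('g, 'b) monoid_scheme \<Rightarrow> 'v set \<Rightarrow> ('g \<Rightarrow> 'v \<Rightarrow> 'v) \<Rightarrow> 'g set" where
  "rep_kernel G V \<rho> = {g \<in> carrier G. \<forall>v\<in>V. \<rho> g v = v}"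

abbreviation Theta :: "(int^2^2) monoid" where
  "Theta \<equiv> SL2Z\<lparr>carrier := Gamma_theta\<rparr>"

definition congruence_rep :: "'v set \<Rightarrow> (int^2^2 \<Rightarrow> 'v \<Rightarrow> 'v) \<Rightarrow> bool" where
  "congruence_rep V \<rho> \<longleftrightarrow> (\<exists>n>0. Gamma n \<subseteq> rep_kernel Theta V \<rho>)"

text \<open>
  An extension may be taken on the same space \<open>V\<close>: an extension of an isomorphic copy of \<open>\<rho>\<close>
  can be transported along the isomorphism.
\<close>

definition extendable_rep ::
    "(complex \<Rightarrow> 'v::ab_group_add \<Rightarrow> 'v) \<Rightarrow> 'v set \<Rightarrow> (int^2^2 \<Rightarrow> 'v \<Rightarrow> 'v) \<Rightarrow> bool" where
  "extendable_rep smul V \<rho> \<longleftrightarrow>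
    (\<exists>\<rho>'. fd_rep smul SL2Z V \<rho>' \<and> (\<forall>g\<in>Gamma_theta. \<forall>v\<in>V. \<rho>' g v = \<rho> g v))"

section \<open>Induced representations\<close>

text \<open>
  For a subgroup \<open>H\<close> of finite index in \<open>G\<close>, the representation of \<open>G\<close> induced from a
  representation \<open>\<rho>\<close> of \<open>H\<close> on \<open>V\<close> is realised on the functions \<open>f : G \<rightarrow> V\<close> with
  \<open>f (h x) = \<rho> h (f x)\<close>, on which \<open>G\<close> acts by right translation.
  They are set to \<open>0\<close> outside \<open>carrier G\<close>, so that each one is represented exactly once.
\<close>

definition ind_space ::
    "('g, 'b) monoid_scheme \<Rightarrow> 'g set \<Rightarrow> 'v::zero set \<Rightarrow> ('g \<Rightarrow> 'v \<Rightarrow> 'v) \<Rightarrow> ('g \<Rightarrow> 'v) set" where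
  "ind_space G H V \<rho> =
    {f. (\<forall>x\<in>carrier G. f x \<in> V) \<and> (\<forall>x. x \<notin> carrier G \<longrightarrow> f x = 0) \<and>
        (\<forall>h\<in>H. \<forall>x\<in>carrier G. f (h \<otimes>\<^bsub>G\<^esub> x) = \<rho> h (f x))}"

definition ind_act :: "('g, 'b) monoid_scheme \<Rightarrow> 'g \<Rightarrow> ('g \<Rightarrow> 'v::zero) \<Rightarrow> ('g \<Rightarrow> 'v)" where
  "ind_act G g f = (\<lambda>x. if x \<in> carrier G then f (x \<otimes>\<^bsub>G\<^esub> g) else 0)"

definition fun_scale :: "(complex \<Rightarrow> 'v \<Rightarrow> 'v) \<Rightarrow> complex \<Rightarrow> ('g \<Rightarrow> 'v) \<Rightarrow> ('g \<Rightarrow> 'v)" where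
  "fun_scale smul c f = (\<lambda>x. smul c (f x))"

lemma vector_space_fun_scale:
  assumes "vector_space smul"
  shows "vector_space (fun_scale smul :: complex \<Rightarrow> ('g \<Rightarrow> 'v::ab_group_add) \<Rightarrow> ('g \<Rightarrow> 'v))"
proof -
  interpret vector_space smul by fact
  show ?thesis
    by unfold_locales (auto simp: fun_scale_def scale_right_distrib scale_left_distrib)
qed

end

theory Submission
  imports Defs
begin

text \<open>
  Let \<open>d = dim V\<close>, let \<open>U\<close> be the induced representation, of dimension \<open>3d\<close>, and let \<open>W\<close> be a
  proper nonzero subrepresentation.  Evaluation at the identity maps \<open>W\<close> onto \<open>V\<close>, since \<open>V\<close> is
  irreducible; if \<open>dim W = d\<close>, this is an isomorphism of representations of the theta group, along
  which \<open>V\<close> inherits an action of the full modular group.  So \<open>dim W > d\<close>, and the same bound for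
  an invariant complement of \<open>W\<close> gives \<open>dim W < 2d\<close>.  On the other hand \<open>\<Gamma>(2)\<close> is normal in the
  modular group and of index two in the theta group, so by Clifford theory every \<open>\<Gamma>(2)\<close>-stable
  subspace of \<open>V\<close> has dimension \<open>0\<close>, \<open>d/2\<close> or \<open>d\<close>.  As a representation of \<open>\<Gamma>(2)\<close>, \<open>U\<close> is the sum
  of three conjugates of \<open>V\<close>; hence \<open>2 dim W\<close> is a multiple of \<open>d\<close> and \<open>dim W = 3d/2\<close>.  Since this
  holds for every proper nonzero subrepresentation, \<open>W\<close> and its complement are irreducible.
\<close>

section \<open>Dimensions of subspaces\<close>

text \<open>Containment in a span, rather than equality with one, lets the property pass to
  arbitrary subsets. It has to be carried along as a hypothesis because \<open>dim\<close> takes the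
  default value 0 on infinite-dimensional spaces, and the ambient spaces here may be
  infinite-dimensional.\<close>

definition finite_dim :: "('a::field \<Rightarrow> 'b::ab_group_add \<Rightarrow> 'b) \<Rightarrow> 'b set \<Rightarrow> bool" where
  "finite_dim smul W \<longleftrightarrow> (\<exists>B. finite B \<and> W \<subseteq> module.span smul B)"

context vector_space begin

text \<open>The coordinates of a common element with respect to \<open>A \<union> B\<close> are
  supported both in \<open>A\<close> and in \<open>B\<close>, hence vanish.\<close>

lemma span_Int_span_of_disjoint:
  assumes "independent (A \<union> B)" "A \<inter> B = {}"
  shows "span A \<inter> span B = {0}"
proof -
  have "x = 0" if "x \<in> span A" "x \<in> span B" for x
  proof -
    have "representation A x = representation (A \<union> B) x"
      by (rule representation_extend[symmetric]) (use assms that in auto)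
    moreover have "representation B x = representation (A \<union> B) x"
      by (rule representation_extend[symmetric]) (use assms that in auto)
    ultimately have "representation (A \<union> B) x b = 0" for b
      using representation_ne_zero[of A x b] representation_ne_zero[of B x b] assms(2) by fastforce
    moreover have "x \<in> span (A \<union> B)"
      using that(1) span_mono[of A "A \<union> B"] by blast
    ultimately show "x = 0"
      using sum_nonzero_representation_eq[OF assms(1), of x] by simp
  qed
  then show ?thesis by (auto simp: span_zero)
qed

lemma finite_dim_subset: "finite_dim scale W \<Longrightarrow> X \<subseteq> W \<Longrightarrow> finite_dim scale X"
  unfolding finite_dim_def by blast

lemma finite_dim_basis_extend:
  assumes "finite_dim scale W" "subspace W" "A \<subseteq> W" "independent A"
  obtains B where "A \<subseteq> B" "finite B" "independent B" "span B = W" "card B = dim W"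
proof -
  obtain B where B: "A \<subseteq> B" "B \<subseteq> W" "independent B" "W \<subseteq> span B"
    using maximal_independent_subset_extend[OF assms(3,4)] .
  moreover have "finite B"
    using assms(1) independent_span_bound B unfolding finite_dim_def by blast
  moreover have "span B = W"
    using B assms(2) span_minimal by blast
  ultimately show ?thesis
    using that basis_card_eq_dim by metis
qed

lemma finite_dim_basis:
  assumes "finite_dim scale W" "subspace W"
  obtains B where "finite B" "independent B" "span B = W" "card B = dim W"
  using finite_dim_basis_extend[OF assms, of "{}"] by (auto simp: independent_empty)

lemma subspace_eq_of_dim_eq:
  assumes "finite_dim scale W" "subspace X" "subspace W" "X \<subseteq> W" "dim X = dim W"
  shows "X = W"
proof -
  obtain A where A: "independent A" "span A = X" "card A = dim X"
    using finite_dim_basis[OF finite_dim_subset[OF assms(1,4)] assms(2)] by metis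
  obtain B where B: "A \<subseteq> B" "finite B" "span B = W" "card B = dim W"
    using finite_dim_basis_extend[OF assms(1,3) _ A(1)] A(2) assms(4) span_superset by blast
  then have "A = B" using card_subset_eq A assms(5) by metis
  then show ?thesis using A B by auto
qed

lemma dim_eq_0_iff:
  assumes "finite_dim scale W" "subspace W"
  shows "dim W = 0 \<longleftrightarrow> W = {0}"
proof
  assume "dim W = 0"
  obtain B where B: "finite B" "span B = W" "card B = dim W"
    using finite_dim_basis assms by metis
  then have "B = {}" using \<open>dim W = 0\<close> by simp
  then show "W = {0}" using B by simp
qed (use dim_le_card[of W "{}"] in simp)

end

section \<open>Kernel and image of a linear map restricted to a subspace\<close>

context vector_space_pair begin

text \<open>Every \<open>w\<close> differs by a kernel element from a combination of lifts of the
  generators of the image. This supplies the finiteness that \<open>rank_nullity\<close> presupposes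
  when the induced space is built up coset by coset.\<close>

lemma finite_dim_of_kernel_image:
  assumes f: "Vector_Spaces.linear s1 s2 f" and W: "vs1.subspace W"
    and ker: "finite_dim s1 {w \<in> W. f w = 0}" and im: "finite_dim s2 (f ` W)"
  shows "finite_dim s1 W"
proof -
  obtain A where A: "finite A" "{w \<in> W. f w = 0} \<subseteq> vs1.span A"
    using ker unfolding finite_dim_def by blast
  obtain C where C: "finite C" "vs2.span C = f ` W"
    using vs2.finite_dim_basis[OF im] linear_subspace_image[OF f W] by metis
  then obtain D where D: "finite D" "D \<subseteq> W" "f ` D = C"
    using finite_subset_image[of C f W] vs2.span_superset[of C] by metis
  have "w \<in> vs1.span (A \<union> D)" if "w \<in> W" for w
  proof -
    have "f w \<in> f ` vs1.span D"
      using that C D linear_span_image[OF f] by blast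
    then obtain x where x: "x \<in> vs1.span D" "f w = f x" by blast
    have "x \<in> W" using x D W vs1.span_minimal by blast
    then have "w - x \<in> vs1.span A"
      using A that W x(2) vs1.subspace_diff linear_diff[OF f] by auto
    then have "(w - x) + x \<in> vs1.span (A \<union> D)"
      using x(1) vs1.span_mono[of A "A \<union> D"] vs1.span_mono[of D "A \<union> D"]
      by (intro vs1.span_add) auto
    then show ?thesis by simp
  qed
  then show ?thesis using A(1) D(1) unfolding finite_dim_def by (meson finite_UnI subsetI)
qed

lemma rank_nullity:
  assumes f: "Vector_Spaces.linear s1 s2 f" and W: "vs1.subspace W" and fd: "finite_dim s1 W"
  shows "vs1.dim W = vs1.dim {w \<in> W. f w = 0} + vs2.dim (f ` W)"
proof -
  let ?K = "{w \<in> W. f w = 0}"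
  have K: "vs1.subspace ?K"
    using linear_subspace_kernel[OF f] W vs1.subspace_inter[of W "{x. f x = 0}"]
    by (simp add: Collect_conj_eq)
  obtain A where A: "finite A" "vs1.independent A" "vs1.span A = ?K" "card A = vs1.dim ?K"
    using vs1.finite_dim_basis[OF vs1.finite_dim_subset[OF fd] K] by blast
  have "A \<subseteq> W" using A(3) vs1.span_superset[of A] by blast
  obtain B where B: "A \<subseteq> B" "finite B" "vs1.independent B" "vs1.span B = W" "card B = vs1.dim W"
    using vs1.finite_dim_basis_extend[OF fd W \<open>A \<subseteq> W\<close> A(2)] .
  have AB: "A \<union> (B - A) = B" using B(1) by blast
  have "vs1.span A \<inter> vs1.span (B - A) = {0}"
    using vs1.span_Int_span_of_disjoint[of A "B - A"] B(3) unfolding AB by blast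
  moreover have "vs1.span (B - A) \<subseteq> W" using B(4) vs1.span_mono[of "B - A" B] by blast
  ultimately have inj: "inj_on f (vs1.span (B - A))"
    unfolding linear_inj_on_iff_eq_0[OF f vs1.subspace_span] A(3) by blast
  have ind: "vs2.independent (f ` (B - A))"
    using linear_independent_injective_image[OF f _ inj] vs1.independent_mono[OF B(3)] by blast
  have "f ` W = vs2.span (f ` B)" using B(4) linear_span_image[OF f] by blast
  also have "f ` B \<subseteq> insert 0 (f ` (B - A))" 
    using A(3) vs1.span_superset[of A] by blast
  then have "vs2.span (f ` B) = vs2.span (f ` (B - A))"
    using vs2.span_mono vs2.span_insert_0 by (metis Diff_subset image_mono subset_antisym)
  finally have "vs2.dim (f ` W) = card (f ` (B - A))"
    using vs2.dim_span_eq_card_independent[OF ind] by simp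
  also have "\<dots> = card (B - A)"
    using card_image inj_on_subset[OF inj vs1.span_superset] by blast
  also have "\<dots> = card B - card A" using card_Diff_subset A(1) B(1) by blast
  finally show ?thesis using A(4) B(5) card_mono[OF B(2,1)] by linarith
qed

end

context vector_space begin

lemma exists_projection_onto:
  assumes "subspace W"
  obtains p where "Vector_Spaces.linear scale scale p" "range p \<subseteq> W" "\<And>w. w \<in> W \<Longrightarrow> p w = w"
proof -
  interpret vector_space_pair scale scale ..
  show ?thesis
    using linear_exists_left_inverse_on[of "\<lambda>x. x" W] assms that linear_ident by auto
qed

text \<open>Subtracting a projection onto \<open>W1\<close> gives a map \<open>q\<close> that kills
  exactly \<open>W1\<close>. It has the same image on \<open>V\<close> as on \<open>W2\<close>, and
  it is injective on \<open>W2\<close>; comparing \<open>rank_nullity\<close> for \<open>V\<close>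
  and for \<open>W2\<close> gives the sum.\<close>

lemma dim_internal_direct_sum:
  assumes "finite_dim scale V" "subspace V" "subspace W1" "subspace W2" "internal_direct_sum V W1 W2"
  shows "dim V = dim W1 + dim W2"
proof -
  interpret vector_space_pair scale scale ..
  have V: "V = {w1 + w2 | w1 w2. w1 \<in> W1 \<and> w2 \<in> W2}" and W: "W1 \<inter> W2 = {0}"
    using assms(5) unfolding internal_direct_sum_def by auto
  have sub: "W1 \<subseteq> V" "W2 \<subseteq> V"
    using V subspace_0[OF assms(3)] subspace_0[OF assms(4)] by force+
  obtain p where p: "Vector_Spaces.linear scale scale p" "range p \<subseteq> W1" "\<And>w. w \<in> W1 \<Longrightarrow> p w = w"
    using exists_projection_onto[OF assms(3)] by blast
  define q where "q x = x - p x" for x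
  have q: "Vector_Spaces.linear scale scale q"
    unfolding q_def using linear_compose_sub[OF linear_ident p(1)] .
  have q0: "q x = 0 \<longleftrightarrow> x \<in> W1" for x
    unfolding q_def using p(2,3) by (metis eq_iff_diff_eq_0 range_subsetD)
  have "q ` V = q ` W2"
  proof
    show "q ` V \<subseteq> q ` W2"
      unfolding V by (auto simp: linear_add[OF q] q0[THEN iffD2])
  qed (use sub in blast)
  moreover have "{w \<in> V. q w = 0} = W1" using q0 sub by blast
  moreover have "{w \<in> W2. q w = 0} = {0}" using q0 W by blast
  moreover have "dim {0} = 0" using dim_le_card[of "{0}" "{}"] by simp
  ultimately show ?thesis
    using rank_nullity[OF q assms(2,1)] rank_nullity[OF q assms(4) finite_dim_subset[OF assms(1) sub(2)]]
    by simp
qed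

end

section \<open>Clifford theory and complete reducibility\<close>

text \<open>The acting elements form an arbitrary set \<open>A\<close>, so that one notion serves
  the whole group, the subgroup \<open>H\<close> and the normal subgroup \<open>N\<close>.\<close>

definition invariant_subspace ::
    "(complex \<Rightarrow> 'v::ab_group_add \<Rightarrow> 'v) \<Rightarrow> 'g set \<Rightarrow> 'v set \<Rightarrow> ('g \<Rightarrow> 'v \<Rightarrow> 'v) \<Rightarrow> 'v set \<Rightarrow> bool" where
  "invariant_subspace smul A V \<rho> W \<longleftrightarrow>
    module.subspace smul W \<and> W \<subseteq> V \<and> (\<forall>g\<in>A. \<forall>w\<in>W. \<rho> g w \<in> W)"

lemma irreducible_rep_iff_invariant_subspace:
  "irreducible_rep smul G V \<rho> \<longleftrightarrow> fd_rep smul G V \<rho> \<and> V \<noteq> {0} \<and>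
    (\<forall>W. invariant_subspace smul (carrier G) V \<rho> W \<longrightarrow> W = {0} \<or> W = V)"
  unfolding irreducible_rep_def invariant_subspace_def by simp

context fd_rep begin

section \<open>Operators of a representation and their effect on subspaces\<close>

lemma finite_dim_carrier: "finite_dim smul V"
  using finite_dim_V unfolding finite_dim_def by blast

lemma act_zero: "g \<in> carrier G \<Longrightarrow> \<rho> g 0 = 0"
  using act_add[of g 0 0] subspace_0[OF subspace_V] by simp

lemma act_sum:
  assumes "g \<in> carrier G" "\<And>i. i \<in> I \<Longrightarrow> f i \<in> V"
  shows "\<rho> g (sum f I) = (\<Sum>i\<in>I. \<rho> g (f i))"
  using assms(2)
proof (induction I rule: infinite_finite_induct)
  case (insert i I)
  then show ?case
    using act_add[OF assms(1), of "f i" "sum f I"] subspace_sum[OF subspace_V, of I f] by simp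
qed (simp_all add: act_zero assms(1))

lemma act_inv_left: "g \<in> carrier G \<Longrightarrow> v \<in> V \<Longrightarrow> \<rho> (inv g) (\<rho> g v) = v"
  using act_mult[of "inv g" g v] act_one by simp

lemma act_inv_right: "g \<in> carrier G \<Longrightarrow> v \<in> V \<Longrightarrow> \<rho> g (\<rho> (inv g) v) = v"
  using act_mult[of g "inv g" v] act_one by simp

lemma fd_rep_invariant_subspace:
  assumes "invariant_subspace smul (carrier G) V \<rho> W"
  shows "fd_rep smul G W \<rho>"
proof
  have W: "subspace W" "W \<subseteq> V" "\<And>g w. g \<in> carrier G \<Longrightarrow> w \<in> W \<Longrightarrow> \<rho> g w \<in> W"
    using assms unfolding invariant_subspace_def by auto
  then show "subspace W" "\<And>g w. g \<in> carrier G \<Longrightarrow> w \<in> W \<Longrightarrow> \<rho> g w \<in> W" by auto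
  show "\<exists>B. finite B \<and> span B = W"
    using finite_dim_basis[OF finite_dim_subset[OF finite_dim_carrier W(2)] W(1)] by metis
qed (use assms act_add act_scale act_one act_mult in \<open>auto simp: invariant_subspace_def subset_iff\<close>)

lemma subspace_act_image:
  assumes "g \<in> carrier G" "subspace Y" "Y \<subseteq> V"
  shows "subspace (\<rho> g ` Y)"
proof (rule subspaceI)
  show "0 \<in> \<rho> g ` Y" using act_zero[OF assms(1)] subspace_0[OF assms(2)] by (metis image_eqI)
  show "x + y \<in> \<rho> g ` Y" if xy: "x \<in> \<rho> g ` Y" "y \<in> \<rho> g ` Y" for x y
  proof -
    obtain a b where "a \<in> Y" "b \<in> Y" "x = \<rho> g a" "y = \<rho> g b" using xy by blast
    then show ?thesis
      using act_add[OF assms(1), of a b] assms(3) subspace_add[OF assms(2)] by (metis image_eqI subsetD)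
  qed
  show "smul c x \<in> \<rho> g ` Y" if x: "x \<in> \<rho> g ` Y" for c x
  proof -
    obtain a where "a \<in> Y" "x = \<rho> g a" using x by blast
    then show ?thesis
      using act_scale[OF assms(1), of a c] assms(3) subspace_scale[OF assms(2)]
      by (metis image_eqI subsetD)
  qed
qed

text \<open>The operator \<open>\<rho> g\<close> is only known to be linear on \<open>V\<close>, so
  the results on linear maps of the ambient space do not apply directly. Instead, operators do not
  raise dimension, and this bound is applied to \<open>g\<close> and to its inverse.\<close>

lemma dim_act_image:
  assumes "g \<in> carrier G" "subspace Y" "Y \<subseteq> V"
  shows "dim (\<rho> g ` Y) = dim Y"
proof -
  have le: "dim (\<rho> h ` X) \<le> dim X" if h: "h \<in> carrier G" and X: "subspace X" "X \<subseteq> V" for h X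
  proof -
    obtain B where B: "finite B" "span B = X" "card B = dim X"
      using finite_dim_basis[OF finite_dim_subset[OF finite_dim_carrier X(2)] X(1)] by metis
    \<comment> \<open>This subspace contains the basis \<open>B\<close>, hence all of
      \<open>X\<close>; that is how linearity on \<open>V\<close> enters.\<close>
    have "subspace {x \<in> V. \<rho> h x \<in> span (\<rho> h ` B)}"
      using act_add[OF h] act_scale[OF h] act_zero[OF h] subspace_V
      by (intro subspaceI)
        (auto simp: subspace_0 subspace_add subspace_scale span_zero span_add span_scale)
    moreover have "B \<subseteq> {x \<in> V. \<rho> h x \<in> span (\<rho> h ` B)}"
      using B(2) X(2) span_superset[of B] span_superset[of "\<rho> h ` B"] by blast
    ultimately have "X \<subseteq> {x \<in> V. \<rho> h x \<in> span (\<rho> h ` B)}"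
      using span_minimal B(2) by blast
    then have "dim (\<rho> h ` X) \<le> card (\<rho> h ` B)"
      using B(1) by (intro dim_le_card) auto
    then show ?thesis using card_image_le[OF B(1), of "\<rho> h"] B(3) by linarith
  qed
  have "\<rho> (inv g) ` \<rho> g ` Y = Y"
    using act_inv_left assms(1,3) by (force simp: image_image)
  moreover have "\<rho> g ` Y \<subseteq> V" using act_closed assms(1,3) by blast
  ultimately have "dim Y \<le> dim (\<rho> g ` Y)"
    using le[of "inv g" "\<rho> g ` Y"] subspace_act_image[OF assms] assms(1) by simp
  with le[OF assms] show ?thesis by simp
qed

text \<open>Clifford theory in index two: a proper nonzero \<open>N\<close>-stable subspace \<open>Y\<close> satisfies
  \<open>V = Y \<oplus> sY\<close>, because \<open>Y \<inter> sY\<close> and \<open>Y + sY\<close> are stable under the whole group.\<close>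

lemma dim_dvd_twice_dim_invariant_index2:
  assumes irr: "irreducible_rep smul G V \<rho>"
    and N: "N \<lhd> G" and s: "s \<in> carrier G"
    and cosets: "\<And>g. g \<in> carrier G \<Longrightarrow> g \<in> N \<or> (\<exists>n\<in>N. g = s \<otimes> n)"
    and Y: "invariant_subspace smul N V \<rho> Y"
  shows "dim V dvd 2 * dim Y"
proof -
  interpret N: normal N G by fact
  have irr': "W = {0} \<or> W = V" if "invariant_subspace smul (carrier G) V \<rho> W" for W
    using irr that unfolding irreducible_rep_iff_invariant_subspace by blast
  have Ysub: "subspace Y" and YV: "Y \<subseteq> V" and YN: "\<And>n y. n \<in> N \<Longrightarrow> y \<in> Y \<Longrightarrow> \<rho> n y \<in> Y"
    using Y unfolding invariant_subspace_def by auto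
  \<comment> \<open>Were \<open>s \<otimes> s\<close> in the coset of \<open>s\<close>, cancelling
    would put \<open>s\<close>, and so its square, into \<open>N\<close> anyway.\<close>
  have "s \<otimes> s \<in> N"
    using cosets[of "s \<otimes> s"] s by (metis N.mem_carrier N.m_closed Units_eq Units_l_cancel m_closed)
  define Z where "Z = \<rho> s ` Y"
  have Zsub: "subspace Z" and Zdim: "dim Z = dim Y" and ZV: "Z \<subseteq> V"
    using subspace_act_image[OF s Ysub YV] dim_act_image[OF s Ysub YV] act_closed[OF s] YV
    unfolding Z_def by auto
  have ZN: "\<rho> n z \<in> Z" if nz: "n \<in> N" "z \<in> Z" for n z
  proof -
    obtain y where y: "y \<in> Y" "z = \<rho> s y" using nz(2) unfolding Z_def by blast
    have n: "n \<in> carrier G" using that(1) by simp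
    have n': "inv s \<otimes> n \<otimes> s \<in> N" using N.inv_op_closed1 s that(1) by simp
    have "\<rho> n z = \<rho> (n \<otimes> s) y" using act_mult n s y YV by auto
    also have "n \<otimes> s = s \<otimes> (inv s \<otimes> n \<otimes> s)" using s n by (simp add: m_assoc[symmetric])
    finally show ?thesis
      using act_mult[OF s] n' y YV YN[OF n'] unfolding Z_def by auto
  qed
  have YZ: "\<rho> s y \<in> Z" if "y \<in> Y" for y using that unfolding Z_def by blast
  have ZY: "\<rho> s z \<in> Y" if "z \<in> Z" for z
    using that act_mult[OF s s] YV YN[OF \<open>s \<otimes> s \<in> N\<close>] unfolding Z_def by force
  \<comment> \<open>As \<open>N\<close> and \<open>s\<close> together give every element of the
    group, stability under these two suffices.\<close>
  have extend: "\<rho> g x \<in> X"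
    if prem: "g \<in> carrier G" "x \<in> X" "X \<subseteq> V" "\<And>n x. n \<in> N \<Longrightarrow> x \<in> X \<Longrightarrow> \<rho> n x \<in> X"
      "\<And>x. x \<in> X \<Longrightarrow> \<rho> s x \<in> X" for g x X
  proof -
    consider "g \<in> N" | n where "n \<in> N" "g = s \<otimes> n" using cosets[OF prem(1)] by blast
    then show ?thesis
    proof cases
      case 2
      then have "\<rho> g x = \<rho> s (\<rho> n x)" using act_mult[OF s] prem(2,3) by auto
      then show ?thesis using prem(2,4,5) 2(1) by simp
    qed (use prem(2,4) in simp)
  qed
  have "invariant_subspace smul (carrier G) V \<rho> (Y \<inter> Z)"
    unfolding invariant_subspace_def
  proof (intro conjI ballI)
    show "subspace (Y \<inter> Z)" using subspace_inter[OF Ysub Zsub] .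
    show "Y \<inter> Z \<subseteq> V" using YV by blast
    fix g x assume "g \<in> carrier G" "x \<in> Y \<inter> Z"
    then show "\<rho> g x \<in> Y \<inter> Z"
      by (rule extend) (use YV YN ZN YZ ZY in auto)
  qed
  moreover have "invariant_subspace smul (carrier G) V \<rho> {y + z | y z. y \<in> Y \<and> z \<in> Z}"
    unfolding invariant_subspace_def
  proof (intro conjI ballI)
    show "subspace {y + z | y z. y \<in> Y \<and> z \<in> Z}" using subspace_sums[OF Ysub Zsub] .
    show sub: "{y + z | y z. y \<in> Y \<and> z \<in> Z} \<subseteq> V"
      using YV ZV subspace_add[OF subspace_V] by blast
    fix g x assume "g \<in> carrier G" "x \<in> {y + z | y z. y \<in> Y \<and> z \<in> Z}"
    then show "\<rho> g x \<in> {y + z | y z. y \<in> Y \<and> z \<in> Z}"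
    proof (rule extend[OF _ _ sub])
      fix n x assume "n \<in> N" "x \<in> {y + z | y z. y \<in> Y \<and> z \<in> Z}"
      then obtain y z where "y \<in> Y" "z \<in> Z" "x = y + z" by blast
      moreover from this have "\<rho> n x = \<rho> n y + \<rho> n z"
        using act_add[OF N.mem_carrier[OF \<open>n \<in> N\<close>], of y z] YV ZV by blast
      ultimately show "\<rho> n x \<in> {y + z | y z. y \<in> Y \<and> z \<in> Z}"
        using YN ZN \<open>n \<in> N\<close> by blast
    next
      fix x assume "x \<in> {y + z | y z. y \<in> Y \<and> z \<in> Z}"
      then obtain y z where yz: "y \<in> Y" "z \<in> Z" "x = y + z" by blast
      then have "\<rho> s x = \<rho> s z + \<rho> s y"
        using act_add[OF s, of y z] YV ZV by (auto simp: add.commute)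
      then show "\<rho> s x \<in> {y + z | y z. y \<in> Y \<and> z \<in> Z}"
        using YZ ZY yz by blast
    qed
  qed
  ultimately consider "Y \<inter> Z = V" | "{y + z | y z. y \<in> Y \<and> z \<in> Z} = {0}"
    | "Y \<inter> Z = {0}" "{y + z | y z. y \<in> Y \<and> z \<in> Z} = V"
    using irr' by blast
  then show ?thesis
  proof cases
    case 1
    then have "Y = V" using YV by blast
    then show ?thesis by simp
  next
    case 2
    then have "Y = {0}"
      using subspace_0[OF Ysub] subspace_0[OF Zsub] by force
    then have "dim Y = 0" using dim_le_card[of Y "{}"] by simp
    then show ?thesis by simp
  next
    case 3
    then have "internal_direct_sum V Y Z" unfolding internal_direct_sum_def by simp
    then have "dim V = 2 * dim Y"
      using dim_internal_direct_sum[OF finite_dim_carrier subspace_V Ysub Zsub] Zdim by simp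
    then show ?thesis by simp
  qed
qed

text \<open>Maschke's theorem: a projection onto \<open>W\<close> is averaged into an equivariant
  map \<open>Q\<close> onto \<open>W\<close>, and the kernel of \<open>Q\<close> in \<open>V\<close>
  is the complement. Only the set of operators is assumed finite, which is what a congruence
  representation of an infinite group provides.\<close>

lemma invariant_complement:
  assumes fin: "finite ((\<lambda>g. restrict (\<rho> g) V) ` carrier G)"
    and inv: "invariant_subspace smul (carrier G) V \<rho> W"
  obtains W' where "invariant_subspace smul (carrier G) V \<rho> W'" "internal_direct_sum V W W'"
proof -
  have W: "subspace W" "W \<subseteq> V" "\<And>g w. g \<in> carrier G \<Longrightarrow> w \<in> W \<Longrightarrow> \<rho> g w \<in> W"
    using inv unfolding invariant_subspace_def by auto
  obtain p where p: "Vector_Spaces.linear smul smul p" "range p \<subseteq> W" "\<And>w. w \<in> W \<Longrightarrow> p w = w"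
    using exists_projection_onto[OF W(1)] by blast
  interpret p: Vector_Spaces.linear smul smul p by fact
  let ?F = "\<lambda>g. restrict (\<rho> g) V"
  \<comment> \<open>\<open>G\<close> may be infinite: average over one group element for each of the finitely many operators.\<close>
  define rep where "rep g = inv_into (carrier G) ?F (?F g)" for g
  have rep: "rep g \<in> carrier G" "?F (rep g) = ?F g" if "g \<in> carrier G" for g
    unfolding rep_def using that by (auto intro: inv_into_into f_inv_into_f)
  define R where "R = rep ` carrier G"
  have R: "R \<subseteq> carrier G" using rep unfolding R_def by blast
  have "R = inv_into (carrier G) ?F ` ?F ` carrier G"
    unfolding R_def rep_def by (simp add: image_image)
  then have finR: "finite R" using fin by simp
  have "\<one> \<in> carrier G" by simp
  then have "card R \<noteq> 0" using finR unfolding R_def by auto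
  have rep_act: "\<rho> (rep g) v = \<rho> g v" if "g \<in> carrier G" "v \<in> V" for g v
    using rep(2)[OF that(1)] that(2) by (metis restrict_apply')
  \<comment> \<open>\<open>rep g\<close> depends only on the operator of \<open>g\<close>, so
    \<open>R\<close> holds exactly one element for each operator.\<close>
  have rep_eqI: "rep g = rep h" if "\<And>v. v \<in> V \<Longrightarrow> \<rho> g v = \<rho> h v" for g h
    unfolding rep_def using that by (metis restrict_ext)
  have rep_id: "rep r = r" if "r \<in> R" for r
    using that rep_eqI rep_act unfolding R_def by blast
  \<comment> \<open>The projection conjugated by \<open>g\<close>. Like \<open>rep\<close>, it
    depends on \<open>g\<close> only through its operator on \<open>V\<close>, as
    \<open>T_rep\<close> records.\<close>
  define T where "T g v = \<rho> g (p (\<rho> (inv g) v))" for g v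
  have pV: "p v \<in> V" for v using p(2) W(2) by blast
  have TW: "T g v \<in> W" if "g \<in> carrier G" for g v
    unfolding T_def using W(3) that p(2) by blast
  have inv_rep: "\<rho> (inv (rep g)) v = \<rho> (inv g) v" if "g \<in> carrier G" "v \<in> V" for g v
    using that rep(1) rep_act act_inv_left act_inv_right act_closed inv_closed by metis
  have T_rep: "T (rep g) v = T g v" if "g \<in> carrier G" "v \<in> V" for g v
    unfolding T_def using inv_rep rep_act pV that by simp
  have T_mult: "T (h \<otimes> g) (\<rho> h v) = \<rho> h (T g v)"
    if "h \<in> carrier G" "g \<in> carrier G" "v \<in> V" for h g v
    unfolding T_def using that pV act_mult act_closed act_inv_left by (simp add: inv_mult_group)
  define Q where "Q v = smul (1 / of_nat (card R)) (\<Sum>r\<in>R. T r v)" for v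
  have sumW: "(\<Sum>r\<in>R. T r v) \<in> W" for v
    using TW R by (intro subspace_sum[OF W(1)]) blast
  have QW: "Q v \<in> W" for v
    unfolding Q_def using sumW subspace_scale[OF W(1)] by blast
  have Q_id: "Q w = w" if "w \<in> W" for w
  proof -
    have "T r w = w" if "r \<in> R" for r
      unfolding T_def using that R \<open>w \<in> W\<close> W(2,3) p(3) act_inv_right by (metis inv_closed subsetD)
    then have "(\<Sum>r\<in>R. T r w) = smul (of_nat (card R)) w"
      by (simp add: sum_constant_scale)
    then show ?thesis unfolding Q_def using \<open>card R \<noteq> 0\<close> by simp
  qed
  have Q_act: "Q (\<rho> h v) = \<rho> h (Q v)" if h: "h \<in> carrier G" and v: "v \<in> V" for h v
  proof -
    \<comment> \<open>\<open>R\<close> need not be closed under multiplication by \<open>h\<close>.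
      Multiplying and then returning to the representative permutes \<open>R\<close>, which replaces
      the usual reindexing of the average.\<close>
    have inj: "inj_on (\<lambda>r. rep (h \<otimes> r)) R"
    proof (rule inj_onI)
      fix r r' assume r: "r \<in> R" "r' \<in> R" "rep (h \<otimes> r) = rep (h \<otimes> r')"
      have "\<rho> r x = \<rho> r' x" if x: "x \<in> V" for x
      proof -
        have rr: "r \<in> carrier G" "r' \<in> carrier G" using r R by blast+
        then have "\<rho> (h \<otimes> r) x = \<rho> (h \<otimes> r') x"
          using rep_act[of "h \<otimes> r" x] rep_act[of "h \<otimes> r'" x] r(3) h x by simp
        then have "\<rho> h (\<rho> r x) = \<rho> h (\<rho> r' x)"
          using act_mult h rr x by simp
        then show ?thesis
          using act_inv_left[OF h] act_closed rr x by metis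
      qed
      then show "r = r'" using rep_id rep_eqI r by metis
    qed
    moreover have "(\<lambda>r. rep (h \<otimes> r)) ` R \<subseteq> R" using h R unfolding R_def by auto
    ultimately have img: "(\<lambda>r. rep (h \<otimes> r)) ` R = R" using endo_inj_surj[OF finR] by blast
    have "(\<Sum>r\<in>R. T r (\<rho> h v)) = (\<Sum>r\<in>R. T (rep (h \<otimes> r)) (\<rho> h v))"
      using sum.reindex[OF inj, of "\<lambda>r. T r (\<rho> h v)"] img by simp
    also have "\<dots> = (\<Sum>r\<in>R. \<rho> h (T r v))"
      using T_rep T_mult h v R act_closed by (intro sum.cong) auto
    also have "\<dots> = \<rho> h (\<Sum>r\<in>R. T r v)"
      using act_sum[OF h, of R "\<lambda>r. T r v"] TW R W(2) by (metis subsetD)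
    finally show ?thesis
      unfolding Q_def using act_scale[OF h] sumW W(2) by (metis subsetD)
  qed
  have T_add: "T r (v + w) = T r v + T r w" and T_scale: "T r (smul c v) = smul c (T r v)"
    if "r \<in> R" "v \<in> V" "w \<in> V" for r v w c
  proof -
    have r: "r \<in> carrier G" using that(1) R by blast
    then show "T r (v + w) = T r v + T r w" "T r (smul c v) = smul c (T r v)"
      unfolding T_def using that act_add act_scale pV by (simp_all add: p.add p.scale)
  qed
  have Q_add: "Q (v + w) = Q v + Q w" if "v \<in> V" "w \<in> V" for v w
    unfolding Q_def using that T_add by (simp add: sum.distrib scale_right_distrib)
  have Q_scale: "Q (smul c v) = smul c (Q v)" if "v \<in> V" for v c
    unfolding Q_def using that T_scale by (simp add: scale_sum_right[symmetric] mult.commute)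
  define W' where "W' = {v \<in> V. Q v = 0}"
  have "invariant_subspace smul (carrier G) V \<rho> W'"
    unfolding invariant_subspace_def
  proof (intro conjI ballI)
    show "subspace W'"
      using Q_add Q_scale Q_id[of 0] subspace_0[OF W(1)] subspace_V
      by (intro subspaceI) (auto simp: W'_def subspace_0 subspace_add subspace_scale)
  qed (auto simp: W'_def act_closed Q_act act_zero)
  moreover have "internal_direct_sum V W W'"
    unfolding internal_direct_sum_def
  proof (intro conjI subset_antisym subsetI)
    fix v assume v: "v \<in> V"
    have "Q (v - Q v) + Q (Q v) = Q v"
      using Q_add[of "v - Q v" "Q v"] v QW W(2) subspace_diff[OF subspace_V] by (simp add: subsetD)
    then have "Q (v - Q v) = 0" using Q_id QW by simp
    then have "v - Q v \<in> W'"
      unfolding W'_def using v QW W(2) subspace_diff[OF subspace_V] by (simp add: subsetD)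
    moreover have "v = Q v + (v - Q v)" by simp
    ultimately show "v \<in> {w1 + w2 | w1 w2. w1 \<in> W \<and> w2 \<in> W'}" using QW by blast
  next
    fix v assume "v \<in> {w1 + w2 | w1 w2. w1 \<in> W \<and> w2 \<in> W'}"
    then show "v \<in> V" using W(2) subspace_add[OF subspace_V] unfolding W'_def by blast
  next
    fix v assume "v \<in> W \<inter> W'"
    then show "v \<in> {0}" using Q_id unfolding W'_def by auto
  next
    fix v :: 'v assume "v \<in> {0}"
    then show "v \<in> W \<inter> W'"
      using subspace_0[OF W(1)] W(2) Q_id unfolding W'_def by auto
  qed
  ultimately show ?thesis using that by blast
qed

end

section \<open>Induced representations\<close>

lemma fun_scale_apply: "fun_scale smul c f x = smul c (f x)"
  by (simp add: fun_scale_def)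

locale induced_rep =
  fixes smul :: "complex \<Rightarrow> 'v::ab_group_add \<Rightarrow> 'v" and G :: "('g, 'b) monoid_scheme" (structure)
    and H :: "'g set" and V :: "'v set" and \<rho> :: "'g \<Rightarrow> 'v \<Rightarrow> 'v"
  assumes grp: "group G" and sub: "subgroup H G" and rep: "fd_rep smul (G\<lparr>carrier := H\<rparr>) V \<rho>"

sublocale induced_rep \<subseteq> group G by (rule grp)
sublocale induced_rep \<subseteq> H: subgroup H G by (rule sub)
sublocale induced_rep \<subseteq> base: fd_rep smul "G\<lparr>carrier := H\<rparr>" V \<rho>
  rewrites "carrier (G\<lparr>carrier := H\<rparr>) = H" and "monoid.mult (G\<lparr>carrier := H\<rparr>) = monoid.mult G"
    and "one (G\<lparr>carrier := H\<rparr>) = one G"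
  by (simp_all add: rep)
sublocale induced_rep \<subseteq> funs: vector_space "fun_scale smul :: complex \<Rightarrow> ('g \<Rightarrow> 'v) \<Rightarrow> 'g \<Rightarrow> 'v"
  by (rule vector_space_fun_scale[OF base.vector_space_axioms])
sublocale induced_rep \<subseteq> eval: vector_space_pair "fun_scale smul :: complex \<Rightarrow> ('g \<Rightarrow> 'v) \<Rightarrow> 'g \<Rightarrow> 'v" smul
  ..

context induced_rep begin

abbreviation U :: "('g \<Rightarrow> 'v) set" where
  "U \<equiv> ind_space G H V \<rho>"

section \<open>The space of equivariant functions and evaluation at group elements\<close>

lemma linear_eval: "Vector_Spaces.linear (fun_scale smul) smul (\<lambda>f :: 'g \<Rightarrow> 'v. f x)"
  unfolding Vector_Spaces.linear_iff
  using base.vector_space_axioms funs.vector_space_axioms by (simp add: fun_scale_def)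

lemma ind_space_in: "f \<in> U \<Longrightarrow> x \<in> carrier G \<Longrightarrow> f x \<in> V"
  and ind_space_outside: "f \<in> U \<Longrightarrow> x \<notin> carrier G \<Longrightarrow> f x = 0"
  and ind_space_equivariant: "f \<in> U \<Longrightarrow> h \<in> H \<Longrightarrow> x \<in> carrier G \<Longrightarrow> f (h \<otimes> x) = \<rho> h (f x)"
  unfolding ind_space_def by auto

lemma subspace_ind_space: "funs.subspace U"
  by (rule funs.subspaceI)
    (auto simp: ind_space_def fun_scale_def base.subspace_V base.subspace_0 base.subspace_add
      base.subspace_scale base.act_zero base.act_add base.act_scale)

lemma ind_act_apply: "x \<in> carrier G \<Longrightarrow> ind_act G g f x = f (x \<otimes> g)"
  by (simp add: ind_act_def)

lemma fd_rep_ind: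
  assumes "finite_dim (fun_scale smul) U"
  shows "fd_rep (fun_scale smul) G U (ind_act G)"
proof
  show "\<exists>B. finite B \<and> funs.span B = U"
    using funs.finite_dim_basis[OF assms subspace_ind_space] by metis
  show "ind_act G g f \<in> U" if "g \<in> carrier G" "f \<in> U" for g f
    using that by (auto simp: ind_space_def ind_act_def m_assoc)
  show "ind_act G \<one> f = f" if "f \<in> U" for f
    using ind_space_outside[OF that] by (auto simp: ind_act_def)
qed (auto simp: subspace_ind_space ind_act_def fun_scale_def m_assoc fun_eq_iff)

text \<open>\<open>R\<close> represents the right cosets of \<open>H\<close>. Functions supported on
  the cosets of a subset of \<open>R\<close> are counted by induction: evaluation at a new
  representative \<open>a\<close> maps onto \<open>V\<close>, and its kernel consists of the
  functions supported on the earlier cosets.\<close>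

lemma finite_dim_and_dim_ind_space:
  assumes "finite R" "R \<subseteq> carrier G"
    and inequiv: "\<And>x y. x \<in> R \<Longrightarrow> y \<in> R \<Longrightarrow> x \<otimes> inv y \<in> H \<Longrightarrow> x = y"
    and cover: "\<And>x. x \<in> carrier G \<Longrightarrow> \<exists>r\<in>R. x \<otimes> inv r \<in> H"
  shows "finite_dim (fun_scale smul) U \<and> funs.dim U = card R * base.dim V"
proof -
  define supp where
    "supp R = {f \<in> U. \<forall>x\<in>carrier G. (\<forall>r\<in>R. x \<otimes> inv r \<notin> H) \<longrightarrow> f x = 0}" for R
  have sub_supp: "funs.subspace (supp R)" for R
    using subspace_ind_space unfolding supp_def
    by (intro funs.subspaceI)
      (auto simp: funs.subspace_0 funs.subspace_add funs.subspace_scale fun_scale_apply)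
  have "finite_dim (fun_scale smul) (supp R) \<and> funs.dim (supp R) = card R * base.dim V"
    using assms(1-3)
  proof (induction R rule: finite_induct)
    case empty
    have "supp {} = {0}"
      using sub_supp[THEN funs.subspace_0] ind_space_outside
      by (fastforce simp: supp_def fun_eq_iff)
    then show ?case
      using funs.dim_le_card[of "{0}" "{}"] by (auto simp: finite_dim_def intro!: exI[of _ "{}"])
  next
    case (insert a R)
    have a: "a \<in> carrier G" using insert.prems(1) by simp
    have IH: "finite_dim (fun_scale smul) (supp R)" "funs.dim (supp R) = card R * base.dim V"
      using insert.IH insert.prems by auto
    have ker: "{f \<in> supp (insert a R). f a = 0} = supp R"
    proof (intro subset_antisym subsetI)
      fix f assume f: "f \<in> {f \<in> supp (insert a R). f a = 0}"
      have "f x = 0" if "x \<in> carrier G" "x \<otimes> inv a \<in> H" for x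
        using ind_space_equivariant[of f "x \<otimes> inv a" a] f that a base.act_zero
        by (simp add: supp_def m_assoc)
      then show "f \<in> supp R" using f unfolding supp_def by blast
    next
      fix f assume "f \<in> supp R"
      moreover have "a \<otimes> inv r \<notin> H" if "r \<in> R" for r
        using insert.prems(2)[of a r] insert.hyps(2) that by auto
      ultimately show "f \<in> {f \<in> supp (insert a R). f a = 0}"
        using a unfolding supp_def by blast
    qed
    have im: "(\<lambda>f. f a) ` supp (insert a R) = V"
    proof (intro subset_antisym subsetI)
      fix v assume v: "v \<in> V"
      \<comment> \<open>The unique equivariant function supported on the coset of \<open>a\<close>
        with value \<open>v\<close> at \<open>a\<close>.\<close>
      define f where "f x = (if x \<in> carrier G \<and> x \<otimes> inv a \<in> H then \<rho> (x \<otimes> inv a) v else 0)" for x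
      have coset: "h \<otimes> x \<otimes> inv a \<in> H \<longleftrightarrow> x \<otimes> inv a \<in> H" if "h \<in> H" "x \<in> carrier G" for h x
      proof
        assume "h \<otimes> x \<otimes> inv a \<in> H"
        then have "inv h \<otimes> (h \<otimes> x \<otimes> inv a) \<in> H" using that by blast
        then show "x \<otimes> inv a \<in> H" using that a by (simp add: m_assoc[symmetric])
      qed (use that a in \<open>simp add: m_assoc\<close>)
      have "f \<in> U"
        using v a coset base.act_zero base.act_closed base.subspace_0[OF base.subspace_V]
        by (auto simp: ind_space_def f_def m_assoc base.act_mult)
      then have "f \<in> supp (insert a R)" unfolding supp_def f_def by auto
      moreover have "f a = v" using a v base.act_one unfolding f_def by simp
      ultimately show "v \<in> (\<lambda>f. f a) ` supp (insert a R)" by blast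
    qed (use a ind_space_in in \<open>auto simp: supp_def\<close>)
    have "finite_dim (fun_scale smul) (supp (insert a R))"
      using eval.finite_dim_of_kernel_image[OF linear_eval[of a] sub_supp[of "insert a R"]]
        IH(1) base.finite_dim_carrier unfolding ker im by blast
    moreover from eval.rank_nullity[OF linear_eval[of a] sub_supp this]
    have "funs.dim (supp (insert a R)) = card (insert a R) * base.dim V"
      unfolding ker im using IH(2) insert.hyps by simp
    ultimately show ?case by blast
  qed
  moreover have "supp R = U" unfolding supp_def using cover by blast
  ultimately show ?thesis by simp
qed

text \<open>Evaluation at \<open>r\<close> intertwines the action of \<open>n \<in> N\<close> with that of \<open>r n r\<^sup>-\<^sup>1\<close>; hence
  the dimensions of \<open>N\<close>-stable subspaces of the induced representation are sums of dimensions
  of \<open>N\<close>-stable subspaces of \<open>V\<close>.\<close>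

lemma dvd_dim_invariant_subspace:
  assumes N: "N \<lhd> G" "N \<subseteq> H"
    and V: "\<And>Y. invariant_subspace smul N V \<rho> Y \<Longrightarrow> m dvd k * base.dim Y"
    and R: "finite R" "R \<subseteq> carrier G" "\<And>x. x \<in> carrier G \<Longrightarrow> \<exists>r\<in>R. x \<otimes> inv r \<in> H"
    and fd: "finite_dim (fun_scale smul) U"
    and W: "invariant_subspace (fun_scale smul) N U (ind_act G) W"
  shows "m dvd k * funs.dim W"
proof -
  interpret N: normal N G by fact
  \<comment> \<open>Stated for every stable \<open>W\<close> whose elements are determined by their
    values on \<open>R\<close>. In the induction, the kernel of evaluation at \<open>a\<close> is
    then determined by its values on the remaining representatives.\<close>
  have "m dvd k * funs.dim W"
    if "\<And>f. f \<in> W \<Longrightarrow> (\<And>r. r \<in> R \<Longrightarrow> f r = 0) \<Longrightarrow> f = 0"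
      and "invariant_subspace (fun_scale smul) N U (ind_act G) W" for W
    using R(1,2) that
  proof (induction R arbitrary: W rule: finite_induct)
    case empty
    then have "W \<subseteq> {0}" by blast
    then have "funs.dim W = 0" using funs.dim_le_card[of W "{}"] by simp
    then show ?case by simp
  next
    case (insert a R)
    have a: "a \<in> carrier G" using insert.prems(1) by simp
    have W: "funs.subspace W" "W \<subseteq> U" "\<And>n f. n \<in> N \<Longrightarrow> f \<in> W \<Longrightarrow> ind_act G n f \<in> W"
      using insert.prems(3) unfolding invariant_subspace_def by auto
    have conj: "f (a \<otimes> n) = \<rho> (a \<otimes> n \<otimes> inv a) (f a)" "a \<otimes> n \<otimes> inv a \<in> N"
      if "n \<in> N" "f \<in> W" for n f
    proof -
      show *: "a \<otimes> n \<otimes> inv a \<in> N" using N.inv_op_closed2 a that(1) by simp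
      show "f (a \<otimes> n) = \<rho> (a \<otimes> n \<otimes> inv a) (f a)"
        using ind_space_equivariant[of f "a \<otimes> n \<otimes> inv a" a] * N(2) W(2) that a
        by (auto simp: m_assoc)
    qed
    have "funs.subspace {f \<in> W. f a = 0}"
      using W(1) by (intro funs.subspaceI)
        (auto simp: funs.subspace_0 funs.subspace_add funs.subspace_scale fun_scale_apply)
    moreover have "ind_act G n f a = 0" if "n \<in> N" "f \<in> W" "f a = 0" for n f
      using conj[of n f] that N(2) base.act_zero a by (auto simp: ind_act_apply)
    ultimately have "invariant_subspace (fun_scale smul) N U (ind_act G) {f \<in> W. f a = 0}"
      using W unfolding invariant_subspace_def by blast
    then have "m dvd k * funs.dim {f \<in> W. f a = 0}"
      using insert.prems by (intro insert.IH) auto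
    moreover have "invariant_subspace smul N V \<rho> ((\<lambda>f. f a) ` W)"
      unfolding invariant_subspace_def
    proof (intro conjI ballI)
      show "base.subspace ((\<lambda>f. f a) ` W)"
        using eval.linear_subspace_image[OF linear_eval W(1)] .
      show "(\<lambda>f. f a) ` W \<subseteq> V" using W(2) ind_space_in a by auto
      fix n v assume nv: "n \<in> N" "v \<in> (\<lambda>f. f a) ` W"
      then obtain f where f: "f \<in> W" "v = f a" by blast
      \<comment> \<open>Conjugating back by \<open>a\<close>: the action of \<open>n'\<close> on
        \<open>f\<close> becomes that of \<open>n\<close> after evaluation at
        \<open>a\<close>.\<close>
      define n' where "n' = inv a \<otimes> n \<otimes> a"
      have n': "n' \<in> N" using N.inv_op_closed1 a nv(1) unfolding n'_def by simp
      have "n \<in> carrier G" using nv(1) by simp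
      then have "a \<otimes> n' \<otimes> inv a = n" using a unfolding n'_def by (simp add: m_assoc[symmetric]) (simp add: m_assoc)
      then have "ind_act G n' f a = \<rho> n v" using conj(1)[OF n' f(1)] a f(2) by (simp add: ind_act_apply)
      then show "\<rho> n v \<in> (\<lambda>f. f a) ` W" using W(3)[OF n' f(1)] by (metis image_eqI)
    qed
    then have "m dvd k * base.dim ((\<lambda>f. f a) ` W)" by (rule V)
    ultimately show ?case
      using eval.rank_nullity[OF linear_eval[of a] W(1) funs.finite_dim_subset[OF fd W(2)]]
      by (simp add: distrib_left)
  qed
  moreover have "f = 0" if f: "f \<in> W" and zero: "\<And>r. r \<in> R \<Longrightarrow> f r = 0" for f
  proof
    fix x
    have fU: "f \<in> U" using W f unfolding invariant_subspace_def by blast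
    show "f x = 0 x"
    proof (cases "x \<in> carrier G")
      case True
      then obtain r where r: "r \<in> R" "x \<otimes> inv r \<in> H" using R(3) by blast
      then have "f x = \<rho> (x \<otimes> inv r) (f r)"
        using ind_space_equivariant[OF fU, of "x \<otimes> inv r" r] True R(2) by (auto simp: m_assoc)
      then show ?thesis using zero r base.act_zero by simp
    qed (use ind_space_outside[OF fU] in simp)
  qed
  ultimately show ?thesis using W by blast
qed

text \<open>The image is \<open>H\<close>-stable by equivariance. It is nonzero because translation
  by \<open>x\<close> moves the value at \<open>x\<close> to the identity, so irreducibility of
  \<open>V\<close> leaves only \<open>V\<close> itself.\<close>

lemma eval_one_onto:
  assumes irr: "irreducible_rep smul (G\<lparr>carrier := H\<rparr>) V \<rho>"
    and W: "invariant_subspace (fun_scale smul) (carrier G) U (ind_act G) W" and "W \<noteq> {0}"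
  shows "(\<lambda>f. f \<one>) ` W = V"
proof -
  have W': "funs.subspace W" "W \<subseteq> U" "\<And>g f. g \<in> carrier G \<Longrightarrow> f \<in> W \<Longrightarrow> ind_act G g f \<in> W"
    using W unfolding invariant_subspace_def by auto
  have "invariant_subspace smul H V \<rho> ((\<lambda>f. f \<one>) ` W)"
    unfolding invariant_subspace_def
  proof (intro conjI ballI)
    show "base.subspace ((\<lambda>f. f \<one>) ` W)"
      using eval.linear_subspace_image[OF linear_eval W'(1)] .
    show "(\<lambda>f. f \<one>) ` W \<subseteq> V" using W'(2) ind_space_in by auto
    fix h v assume hv: "h \<in> H" "v \<in> (\<lambda>f. f \<one>) ` W"
    then obtain f where f: "f \<in> W" "v = f \<one>" by blast
    then have "ind_act G h f \<one> = \<rho> h v"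
      using ind_space_equivariant[of f h \<one>] hv(1) W'(2) by (auto simp: ind_act_apply)
    then show "\<rho> h v \<in> (\<lambda>f. f \<one>) ` W" using W'(3)[of h f] f hv(1) by (metis H.mem_carrier image_eqI)
  qed
  moreover have "(\<lambda>f. f \<one>) ` W \<noteq> {0}"
  proof
    assume 0: "(\<lambda>f. f \<one>) ` W = {0}"
    have "f x = 0" if "f \<in> W" for f x
    proof (cases "x \<in> carrier G")
      case True
      then have "ind_act G x f \<one> = f x" by (simp add: ind_act_apply)
      moreover have "ind_act G x f \<one> = 0" using 0 W'(3)[OF True that] by blast
      ultimately show ?thesis by simp
    qed (use ind_space_outside that W'(2) in blast)
    then have "W \<subseteq> {0}" by (auto simp: fun_eq_iff)
    then show False using \<open>W \<noteq> {0}\<close> funs.subspace_0[OF W'(1)] by blast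
  qed
  ultimately show ?thesis
    using irr unfolding irreducible_rep_iff_invariant_subspace by auto
qed

text \<open>The action of \<open>G\<close> on \<open>W\<close> is transported along evaluation at
  the identity. Equivariance of the functions in \<open>W\<close> makes it agree with
  \<open>\<rho>\<close> on \<open>H\<close>.\<close>

lemma extension_of_eval_one_bij:
  assumes fd: "finite_dim (fun_scale smul) U"
    and W: "invariant_subspace (fun_scale smul) (carrier G) U (ind_act G) W"
    and bij: "bij_betw (\<lambda>f. f \<one>) W V"
  obtains \<rho>' where "fd_rep smul G V \<rho>'" "\<And>h v. h \<in> H \<Longrightarrow> v \<in> V \<Longrightarrow> \<rho>' h v = \<rho> h v"
proof -
  interpret W: fd_rep "fun_scale smul" G W "ind_act G"
    using fd_rep.fd_rep_invariant_subspace[OF fd_rep_ind[OF fd] W] .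
  have "W \<subseteq> U" using W unfolding invariant_subspace_def by blast
  define e where "e = inv_into W (\<lambda>f. f \<one>)"
  have e: "e v \<in> W" "e v \<one> = v" if "v \<in> V" for v
    unfolding e_def using that bij
    by (auto simp: bij_betw_def inv_into_into f_inv_into_f[of v "\<lambda>f. f \<one>" W])
  have e_eqI: "e v = f" if "f \<in> W" "f \<one> = v" for f v
    unfolding e_def using that bij by (intro inv_into_f_eq) (auto simp: bij_betw_def)
  have e_add: "e (v + w) = e v + e w" if "v \<in> V" "w \<in> V" for v w
    using e that by (intro e_eqI) (auto simp: funs.subspace_add[OF W.subspace_V])
  have e_scale: "e (smul c v) = fun_scale smul c (e v)" if "v \<in> V" for c v
    using e that by (intro e_eqI funs.subspace_scale[OF W.subspace_V]) (auto simp: fun_scale_def)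
  define \<rho>' where "\<rho>' g v = ind_act G g (e v) \<one>" for g v
  have e_\<rho>': "e (\<rho>' g v) = ind_act G g (e v)" if "g \<in> carrier G" "v \<in> V" for g v
    unfolding \<rho>'_def using that e W.act_closed by (intro e_eqI) auto
  have "fd_rep smul G V \<rho>'"
  proof
    show "base.subspace V" "\<exists>B. finite B \<and> base.span B = V"
      using base.subspace_V base.finite_dim_V by auto
    show "\<rho>' g v \<in> V" if "g \<in> carrier G" "v \<in> V" for g v
      unfolding \<rho>'_def using that e W.act_closed \<open>W \<subseteq> U\<close> ind_space_in by blast
    show "\<rho>' g (v + w) = \<rho>' g v + \<rho>' g w" if "g \<in> carrier G" "v \<in> V" "w \<in> V" for g v w
      unfolding \<rho>'_def using that e e_add W.act_add by simp
    show "\<rho>' g (smul c v) = smul c (\<rho>' g v)" if "g \<in> carrier G" "v \<in> V" for g v c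
      unfolding \<rho>'_def using that e e_scale W.act_scale by (simp add: fun_scale_def)
    show "\<rho>' \<one> v = v" if "v \<in> V" for v
      unfolding \<rho>'_def using that e W.act_one by simp
    show "\<rho>' (g \<otimes> h) v = \<rho>' g (\<rho>' h v)" if "g \<in> carrier G" "h \<in> carrier G" "v \<in> V" for g h v
      using W.act_mult[of g h "e v"] e_\<rho>' that e unfolding \<rho>'_def by simp
  qed
  moreover have "\<rho>' h v = \<rho> h v" if "h \<in> H" "v \<in> V" for h v
    unfolding \<rho>'_def using that e[of v] ind_space_equivariant[of "e v" h \<one>] \<open>W \<subseteq> U\<close>
    by (auto simp: ind_act_apply)
  ultimately show ?thesis using that by blast
qed

text \<open>An abstract form for any group. The modular group enters later only through its data: a
  subgroup of index three, represented by \<open>R\<close>; a normal subgroup \<open>N\<close> with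
  at most two cosets in it; and finitely many operators.\<close>

theorem irreducible_or_sum_of_two_irreducibles:
  assumes irr: "irreducible_rep smul (G\<lparr>carrier := H\<rparr>) V \<rho>"
    and N: "N \<lhd> G" "N \<subseteq> H"
    and s: "s \<in> H" "\<And>h. h \<in> H \<Longrightarrow> h \<in> N \<or> (\<exists>n\<in>N. h = s \<otimes> n)"
    and R: "card R = 3" "R \<subseteq> carrier G"
      "\<And>x y. x \<in> R \<Longrightarrow> y \<in> R \<Longrightarrow> x \<otimes> inv y \<in> H \<Longrightarrow> x = y"
      "\<And>x. x \<in> carrier G \<Longrightarrow> \<exists>r\<in>R. x \<otimes> inv r \<in> H"
    and fin: "finite ((\<lambda>g. restrict (ind_act G g) U) ` carrier G)"
    and not_ext: "\<nexists>\<rho>'. fd_rep smul G V \<rho>' \<and> (\<forall>h\<in>H. \<forall>v\<in>V. \<rho>' h v = \<rho> h v)"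
  shows "irreducible_rep (fun_scale smul) G U (ind_act G) \<and> funs.dim U = 3 * base.dim V
    \<or> sum_of_two_irreducibles (fun_scale smul) G U (ind_act G) (3 / 2 * real (base.dim V))"
proof -
  let ?d = "base.dim V"
  let ?inv = "invariant_subspace (fun_scale smul) (carrier G) U (ind_act G)"
  have finR: "finite R" using R(1) card.infinite by fastforce
  have fd: "finite_dim (fun_scale smul) U" and dimU: "funs.dim U = 3 * ?d"
    using finite_dim_and_dim_ind_space[OF finR R(2-4)] R(1) by auto
  interpret ind: fd_rep "fun_scale smul" G U "ind_act G" by (rule fd_rep_ind[OF fd])
  have "V \<noteq> {0}" using irr unfolding irreducible_rep_def by blast
  then have "?d > 0"
    using base.dim_eq_0_iff[OF base.finite_dim_carrier base.subspace_V] by simp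
  have subspD: "funs.subspace W" "W \<subseteq> U" "finite_dim (fun_scale smul) W" if "?inv W" for W
    using that funs.finite_dim_subset[OF fd] unfolding invariant_subspace_def by auto
  have above: "?d < funs.dim W" if W: "?inv W" and "W \<noteq> {0}" for W
  proof -
    note Ws = subspD[OF W]
    let ?K = "{f \<in> W. f \<one> = 0}"
    have onto: "(\<lambda>f. f \<one>) ` W = V" using eval_one_onto[OF irr W \<open>W \<noteq> {0}\<close>] .
    have "funs.dim ?K \<noteq> 0"
    proof
      assume "funs.dim ?K = 0"
      moreover have "funs.subspace ?K"
        using Ws(1) by (intro funs.subspaceI)
          (auto simp: funs.subspace_0 funs.subspace_add funs.subspace_scale fun_scale_apply)
      ultimately have "?K = {0}"
        using funs.dim_eq_0_iff funs.finite_dim_subset[OF Ws(3), of ?K] by blast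
      then have "inj_on (\<lambda>f. f \<one>) W"
        using eval.linear_inj_on_iff_eq_0[OF linear_eval Ws(1)] by blast
      then have "bij_betw (\<lambda>f. f \<one>) W V" using onto by (simp add: bij_betw_def)
      then show False using extension_of_eval_one_bij[OF fd W] not_ext by metis
    qed
    then show ?thesis using eval.rank_nullity[OF linear_eval[of \<one>] Ws(1,3)] onto by simp
  qed
  have d_dvd: "?d dvd 2 * base.dim Y" if "invariant_subspace smul N V \<rho> Y" for Y
  proof (rule base.dim_dvd_twice_dim_invariant_index2[OF irr _ _ _ that])
    show "N \<lhd> G\<lparr>carrier := H\<rparr>" using normal_restrict_supergroup[OF sub N] .
    show "s \<in> H" by (rule s(1))
    show "\<And>h. h \<in> H \<Longrightarrow> h \<in> N \<or> (\<exists>n\<in>N. h = s \<otimes> n)" by (rule s(2))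
  qed
  have half: "2 * funs.dim W = 3 * ?d" and compl: "\<exists>W'. ?inv W' \<and> W' \<noteq> {0} \<and> W' \<noteq> U \<and> internal_direct_sum U W W'"
    if W: "?inv W" and proper: "W \<noteq> {0}" "W \<noteq> U" for W
  proof -
    obtain W' where W': "?inv W'" "internal_direct_sum U W W'"
      using ind.invariant_complement[OF fin W] .
    have "W' \<noteq> {0}"
      using W'(2) proper(2) unfolding internal_direct_sum_def by auto
    moreover have "W' \<noteq> U"
      using W'(2) proper(1) subspD(2)[OF W] unfolding internal_direct_sum_def by auto
    ultimately show "\<exists>W'. ?inv W' \<and> W' \<noteq> {0} \<and> W' \<noteq> U \<and> internal_direct_sum U W W'"
      using W' by blast
    have "funs.dim W + funs.dim W' = 3 * ?d"
      using funs.dim_internal_direct_sum[OF fd subspace_ind_space subspD(1)[OF W] subspD(1)[OF W'(1)] W'(2)]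
        dimU by simp
    then have bounds: "?d < funs.dim W" "funs.dim W < 2 * ?d"
      using above[OF W proper(1)] above[OF W'(1) \<open>W' \<noteq> {0}\<close>] by auto
    have "invariant_subspace (fun_scale smul) N U (ind_act G) W"
      using W N(2) H.subset unfolding invariant_subspace_def by blast
    then have "?d dvd 2 * funs.dim W"
      using dvd_dim_invariant_subspace[OF N d_dvd finR R(2,4) fd] by blast
    \<comment> \<open>The bounds on \<open>funs.dim W\<close> put \<open>k\<close> strictly between
      2 and 4.\<close>
    then obtain k where k: "2 * funs.dim W = ?d * k" by (elim dvdE)
    then have "?d * 2 < ?d * k" "?d * k < ?d * 4" using bounds by linarith+
    then have "k = 3" by simp
    then show "2 * funs.dim W = 3 * ?d" using k by simp
  qed
  have irrep: "irreducible_rep (fun_scale smul) G W (ind_act G)"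
    if W: "?inv W" and proper: "W \<noteq> {0}" "W \<noteq> U" for W
    unfolding irreducible_rep_iff_invariant_subspace
  proof (intro conjI allI impI)
    show "fd_rep (fun_scale smul) G W (ind_act G)" by (rule ind.fd_rep_invariant_subspace[OF W])
    fix X assume "invariant_subspace (fun_scale smul) (carrier G) W (ind_act G) X"
    then have X: "?inv X" "X \<subseteq> W"
      using subspD(2)[OF W] unfolding invariant_subspace_def by auto
    show "X = {0} \<or> X = W"
    proof (cases "X = {0}")
      case False
      \<comment> \<open>\<open>X\<close> is itself proper and nonzero in \<open>U\<close>, so
        \<open>half\<close> gives it the same dimension as \<open>W\<close>.\<close>
      moreover have "X \<noteq> U" using X(2) proper(2) subspD(2)[OF W] by blast
      ultimately have "funs.dim X = funs.dim W" using half[OF X(1)] half[OF W proper] by simp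
      then show ?thesis
        using funs.subspace_eq_of_dim_eq[OF subspD(3)[OF W] subspD(1)[OF X(1)] subspD(1)[OF W] X(2)]
        by simp
    qed simp
  qed (rule proper(1))
  show ?thesis
  proof (cases "\<exists>W. ?inv W \<and> W \<noteq> {0} \<and> W \<noteq> U")
    case True
    then obtain W where W: "?inv W" "W \<noteq> {0}" "W \<noteq> U" by blast
    then obtain W' where W': "?inv W'" "W' \<noteq> {0}" "W' \<noteq> U" "internal_direct_sum U W W'"
      using compl by blast
    have "real (funs.dim W) = 3 / 2 * real ?d" "real (funs.dim W') = 3 / 2 * real ?d"
      using half[OF W] half[OF W'(1-3)] by linarith+
    then have "sum_of_two_irreducibles (fun_scale smul) G U (ind_act G) (3 / 2 * real ?d)"
      unfolding sum_of_two_irreducibles_def using W'(4) irrep[OF W] irrep[OF W'(1-3)] by blast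
    then show ?thesis ..
  next
    case False
    have "U \<noteq> {0}"
    proof
      assume "U = {0}"
      then show False
        using funs.dim_eq_0_iff[OF fd subspace_ind_space] dimU \<open>?d > 0\<close> by simp
    qed
    then have "irreducible_rep (fun_scale smul) G U (ind_act G)"
      unfolding irreducible_rep_iff_invariant_subspace using False ind.fd_rep_axioms by blast
    then show ?thesis using dimU by blast
  qed
qed

end

section \<open>The theta group\<close>

definition mat2 :: "int \<Rightarrow> int \<Rightarrow> int \<Rightarrow> int \<Rightarrow> int^2^2" where
  "mat2 a b c d = vector [vector [a, b], vector [c, d]]"

lemma mat2_nth [simp]:
  "mat2 a b c d $ 1 $ 1 = a" "mat2 a b c d $ 1 $ 2 = b"
  "mat2 a b c d $ 2 $ 1 = c" "mat2 a b c d $ 2 $ 2 = d"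
  by (simp_all add: mat2_def)

lemma mat2_eq_iff: "mat2 a b c d = mat2 a' b' c' d' \<longleftrightarrow> a = a' \<and> b = b' \<and> c = c' \<and> d = d'"
  by (auto simp: vec_eq_iff forall_2)

lemma mat2_cases: obtains a b c d where "A = mat2 a b c d"
  by (rule that[of "A$1$1" "A$1$2" "A$2$1" "A$2$2"]) (simp add: vec_eq_iff forall_2)

lemma mat2_mult:
  "mat2 a b c d ** mat2 a' b' c' d'
    = mat2 (a * a' + b * c') (a * b' + b * d') (c * a' + d * c') (c * b' + d * d')"
  by (simp add: vec_eq_iff forall_2 matrix_matrix_mult_def sum_2)

lemma mat_1_eq_mat2: "mat 1 = mat2 1 0 0 1"
  by (simp add: vec_eq_iff forall_2 mat_def)

lemma SL2Z_simps [simp]: "A \<otimes>\<^bsub>SL2Z\<^esub> B = A ** B" "\<one>\<^bsub>SL2Z\<^esub> = mat 1"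
  by (simp_all add: SL2Z_def)

lemma mat2_in_SL2Z [simp]: "mat2 a b c d \<in> carrier SL2Z \<longleftrightarrow> a * d - b * c = 1"
  by (simp add: SL2Z_def det_2)

lemma inv_mat2:
  assumes "a * d - b * c = 1"
  shows "inv\<^bsub>SL2Z\<^esub> (mat2 a b c d) = mat2 d (- b) (- c) a"
  by (rule group.inv_equality[OF group_SL2Z])
    (use assms in \<open>simp_all add: mat2_mult mat_1_eq_mat2 mat2_eq_iff algebra_simps\<close>)

lemma mat2_in_Gamma:
  "mat2 a b c d \<in> Gamma n \<longleftrightarrow> a * d - b * c = 1 \<and>
    [a = 1] (mod int n) \<and> [b = 0] (mod int n) \<and> [c = 0] (mod int n) \<and> [d = 1] (mod int n)"
  unfolding Gamma_def by (simp add: forall_2 mat_1_eq_mat2)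

lemma matrix_cong_mult:
  fixes A B A' B' :: "int^'k^'k"
  assumes "\<And>i j. [A $ i $ j = A' $ i $ j] (mod m)" "\<And>i j. [B $ i $ j = B' $ i $ j] (mod m)"
  shows "[(A ** B) $ i $ j = (A' ** B') $ i $ j] (mod m)"
  unfolding matrix_matrix_mult_def by (simp add: cong_sum cong_mult assms)

text \<open>Multiplying the congruence of \<open>A\<close> and \<open>B\<close> by the inverse of
  \<open>B\<close> gives a matrix congruent to 1. Membership in \<open>Gamma n\<close> is mostly
  obtained this way, without computing entries of inverses.\<close>

lemma mult_inv_in_Gamma:
  assumes "A \<in> carrier SL2Z" "B \<in> carrier SL2Z" "\<And>i j. [A $ i $ j = B $ i $ j] (mod int n)"
  shows "A ** inv\<^bsub>SL2Z\<^esub> B \<in> Gamma n"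
proof -
  interpret group SL2Z by (rule group_SL2Z)
  have "B ** inv\<^bsub>SL2Z\<^esub> B = mat 1" using r_inv[OF assms(2)] by simp
  then have "[(A ** inv\<^bsub>SL2Z\<^esub> B) $ i $ j = mat 1 $ i $ j] (mod int n)" for i j
    using matrix_cong_mult[of A B "int n" "inv\<^bsub>SL2Z\<^esub> B" "inv\<^bsub>SL2Z\<^esub> B" i j] assms(3) by simp
  moreover have "A ** inv\<^bsub>SL2Z\<^esub> B \<in> carrier SL2Z" using assms(1,2) m_closed inv_closed by (metis SL2Z_simps(1))
  ultimately show ?thesis unfolding Gamma_def by blast
qed

lemma normal_Gamma: "Gamma n \<lhd> SL2Z"
proof -
  interpret group SL2Z by (rule group_SL2Z)
  have mem: "A \<in> carrier SL2Z" "[A $ i $ j = mat 1 $ i $ j] (mod int n)" if "A \<in> Gamma n" for A i j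
    using that unfolding Gamma_def by auto
  have "subgroup (Gamma n) SL2Z"
  proof (rule subgroupI)
    show "Gamma n \<subseteq> carrier SL2Z" unfolding Gamma_def by blast
    show "Gamma n \<noteq> {}"
      using mult_inv_in_Gamma[OF one_closed one_closed] by (metis cong_refl empty_iff)
    fix A assume A: "A \<in> Gamma n"
    have "mat 1 ** inv\<^bsub>SL2Z\<^esub> A \<in> Gamma n"
      using mem[OF A] one_closed by (intro mult_inv_in_Gamma) (auto intro: cong_sym)
    then show "inv\<^bsub>SL2Z\<^esub> A \<in> Gamma n" by simp
    fix B assume B: "B \<in> Gamma n"
    have "A ** B \<in> carrier SL2Z" using m_closed[of A B] mem[OF A] mem[OF B] by simp
    then show "A \<otimes>\<^bsub>SL2Z\<^esub> B \<in> Gamma n"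
      using matrix_cong_mult[OF mem(2)[OF A] mem(2)[OF B]] unfolding Gamma_def by simp
  qed
  moreover have "X \<otimes>\<^bsub>SL2Z\<^esub> A \<otimes>\<^bsub>SL2Z\<^esub> inv\<^bsub>SL2Z\<^esub> X \<in> Gamma n"
    if X: "X \<in> carrier SL2Z" and A: "A \<in> Gamma n" for X A
  proof -
    have "X ** A \<in> carrier SL2Z" using m_closed[of X A] X mem[OF A] by simp
    moreover have "[(X ** A) $ i $ j = X $ i $ j] (mod int n)" for i j
      using matrix_cong_mult[of X X "int n" A "mat 1" i j] mem(2)[OF A] by simp
    ultimately show ?thesis using mult_inv_in_Gamma X by simp
  qed
  ultimately show ?thesis using normal_inv_iff by blast
qed

text \<open>For determinant 1, the parity conditions say that the reduction modulo 2 is that of 1 or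
  of \<open>mat_s\<close>; these form a group, which gives one direction. The other is a Euclidean
  algorithm on the first column with even quotients, lowering the absolute value of
  \<open>c\<close>.\<close>

lemma in_Gamma_theta_iff:
  "mat2 a b c d \<in> Gamma_theta \<longleftrightarrow> a * d - b * c = 1 \<and> even (a + d) \<and> even (b + c)"
proof
  interpret group SL2Z by (rule group_SL2Z)
  define K where "K = {A \<in> carrier SL2Z. even (A$1$1 + A$2$2) \<and> even (A$1$2 + A$2$1)}"
  have K: "mat2 a b c d \<in> K \<longleftrightarrow> a * d - b * c = 1 \<and> even (a + d) \<and> even (b + c)" for a b c d
    unfolding K_def by simp
  have "subgroup K SL2Z"
  proof (rule subgroupI)
    show "K \<subseteq> carrier SL2Z" unfolding K_def by blast
    have "mat2 1 0 0 1 \<in> K" unfolding K by simp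
    then show "K \<noteq> {}" by blast
    fix A assume A: "A \<in> K"
    obtain a b c d where A': "A = mat2 a b c d" by (rule mat2_cases)
    show "inv\<^bsub>SL2Z\<^esub> A \<in> K"
      using A unfolding A' K by (simp add: inv_mat2 K algebra_simps)
    fix B assume B: "B \<in> K"
    obtain a' b' c' d' where B': "B = mat2 a' b' c' d'" by (rule mat2_cases)
    have "A ** B \<in> carrier SL2Z" using m_closed[of A B] A B unfolding K_def by simp
    moreover have "even (a + d)" "even (b + c)" "even (a' + d')" "even (b' + c')"
      using A B unfolding A' B' K by auto
    ultimately show "A \<otimes>\<^bsub>SL2Z\<^esub> B \<in> K"
      unfolding A' B' K_def by (auto simp: mat2_mult)
  qed
  moreover have "{mat_s, mat_t_sq} \<subseteq> K"
    unfolding mat_s_def mat_t_sq_def mat2_def[symmetric] by (simp add: K)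
  ultimately have "Gamma_theta \<subseteq> K"
    unfolding Gamma_theta_def by (rule generate_subgroup_incl[rotated])
  then show "a * d - b * c = 1 \<and> even (a + d) \<and> even (b + c)" if "mat2 a b c d \<in> Gamma_theta"
    using that K by blast
next
  interpret H: subgroup Gamma_theta SL2Z by (rule subgroup_Gamma_theta)
  have S: "mat2 0 (- 1) 1 0 \<in> Gamma_theta" and T: "mat2 1 2 0 1 \<in> Gamma_theta"
    unfolding Gamma_theta_def mat_s_def mat_t_sq_def mat2_def by (auto intro: generate.incl)
  have inv: "mat2 d (- b) (- c) a \<in> Gamma_theta"
    if "mat2 a b c d \<in> Gamma_theta" "a * d - b * c = 1" for a b c d
    using H.m_inv_closed[OF that(1)] inv_mat2[OF that(2)] by simp
  have mult: "A ** B \<in> Gamma_theta" if "A \<in> Gamma_theta" "B \<in> Gamma_theta" for A B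
    using H.m_closed[OF that] by simp
  have T_nat: "mat2 1 (2 * int k) 0 1 \<in> Gamma_theta" for k
  proof (induction k)
    case 0
    then show ?case using H.one_closed by (simp add: mat_1_eq_mat2)
  next
    case (Suc k)
    then show ?case using mult[OF T Suc] by (simp add: mat2_mult algebra_simps)
  qed
  have T_int: "mat2 1 (2 * k) 0 1 \<in> Gamma_theta" for k
  proof (cases "k \<ge> 0")
    case True
    then show ?thesis using T_nat[of "nat k"] by simp
  next
    case False
    then show ?thesis using inv[OF T_nat[of "nat (- k)"]] by simp
  qed
  have neg: "mat2 (- a) (- b) (- c) (- d) \<in> Gamma_theta" if "mat2 a b c d \<in> Gamma_theta" for a b c d
    using mult[OF mult[OF S S] that] by (simp add: mat2_mult)
  show "mat2 a b c d \<in> Gamma_theta" if "a * d - b * c = 1 \<and> even (a + d) \<and> even (b + c)"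
    using that
  proof (induction "nat \<bar>c\<bar>" arbitrary: a b c d rule: less_induct)
    case less
    then have det: "a * d - b * c = 1" and par: "even (a + d)" "even (b + c)" by auto
    show ?case
    proof (cases "c = 0")
      case True
      then have "a * d = 1" "even b" using det par by auto
      then have "a = 1 \<and> d = 1 \<or> a = - 1 \<and> d = - 1" by (metis mult.commute zmult_eq_1_iff)
      then show ?thesis
        using T_int[of "b div 2"] neg[OF T_int[of "- b div 2"]] \<open>even b\<close> True by auto
    next
      case False
      \<comment> \<open>Division by \<open>2 * \<bar>c\<bar>\<close>, shifted by
        \<open>\<bar>c\<bar>\<close> so that the remainder \<open>r\<close> is centred: it lies
        between \<open>- \<bar>c\<bar>\<close> inclusive and \<open>\<bar>c\<bar>\<close> exclusive.
        The sign in \<open>k\<close> accounts for that of \<open>c\<close>.\<close>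
      define q where "q = (a + \<bar>c\<bar>) div (2 * \<bar>c\<bar>)"
      define k where "k = - (sgn c * q)"
      define r where "r = a + 2 * k * c"
      have kc: "k * c = - (q * \<bar>c\<bar>)" unfolding k_def by (simp add: abs_sgn mult.commute mult.left_commute)
      have "r + \<bar>c\<bar> = (a + \<bar>c\<bar>) mod (2 * \<bar>c\<bar>)"
        using mult_div_mod_eq[of "2 * \<bar>c\<bar>" "a + \<bar>c\<bar>"] kc unfolding r_def q_def
        by (simp add: algebra_simps)
      then have "0 \<le> r + \<bar>c\<bar>" "r + \<bar>c\<bar> < 2 * \<bar>c\<bar>" using False by simp_all
      \<comment> \<open>At this endpoint the descent would stall. Parity excludes it:
        \<open>a\<close> and \<open>c\<close>, and with them \<open>d\<close> and \<open>b\<close>,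
        would all have the same parity, making the determinant even.\<close>
      moreover have "r + \<bar>c\<bar> \<noteq> 0"
      proof
        assume "r + \<bar>c\<bar> = 0"
        then have "a + c = (c - \<bar>c\<bar>) - 2 * (k * c)" unfolding r_def by (simp add: algebra_simps)
        moreover have "even (c - \<bar>c\<bar>)" by (cases "c \<ge> 0") auto
        ultimately have "even (a + c)" by simp
        moreover have "odd (a * d - b * c)" using det by simp
        ultimately show False using par by auto
      qed
      ultimately have "\<bar>r\<bar> < \<bar>c\<bar>" by linarith
      have det': "(- c) * (b + 2 * k * d) - (- d) * r = 1"
        using det unfolding r_def by (simp add: algebra_simps)
      \<comment> \<open>This is the given matrix multiplied on the left by the \<open>k\<close>-th
        power of \<open>mat_t_sq\<close> and then by \<open>mat_s\<close>, so its lower left entry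
        is the smaller \<open>r\<close>.\<close>
      have red: "mat2 (- c) (- d) r (b + 2 * k * d) \<in> Gamma_theta"
        using \<open>\<bar>r\<bar> < \<bar>c\<bar>\<close> det' par unfolding r_def by (intro less.hyps) auto
      have "mat2 1 (2 * (- k)) 0 1 ** (mat2 0 1 (- 1) 0 ** mat2 (- c) (- d) r (b + 2 * k * d))
          \<in> Gamma_theta"
        by (intro mult T_int red) (use inv[OF S] in simp)
      then show ?thesis unfolding r_def by (simp add: mat2_mult algebra_simps)
    qed
  qed
qed

section \<open>Cosets of \<open>Gamma 2\<close> in the theta group and of the theta group in the
  modular group\<close>

lemma Gamma_2_subset_Gamma_theta: "Gamma 2 \<subseteq> Gamma_theta"
proof
  fix A assume A: "A \<in> Gamma 2"
  obtain a b c d where A': "A = mat2 a b c d" by (rule mat2_cases)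
  show "A \<in> Gamma_theta"
    using A unfolding A' in_Gamma_theta_iff mat2_in_Gamma by (auto simp: cong_def)
qed

lemma Gamma_theta_coset_Gamma_2:
  assumes "h \<in> Gamma_theta"
  shows "h \<in> Gamma 2 \<or> (\<exists>n\<in>Gamma 2. h = mat_s ** n)"
proof -
  obtain a b c d where h: "h = mat2 a b c d" by (rule mat2_cases)
  have det: "a * d - b * c = 1" and par: "even (a + d)" "even (b + c)"
    using assms unfolding h in_Gamma_theta_iff by auto
  then have "odd (a * d - b * c)" by simp
  then consider "odd a" "odd d" "even b" "even c" | "even a" "even d" "odd b" "odd c"
    using par by auto
  then show ?thesis
  proof cases
    case 1
    then show ?thesis
      using det unfolding h mat2_in_Gamma by (simp add: cong_def odd_iff_mod_2_eq_one)
  next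
    case 2
    \<comment> \<open>The second factor is the inverse of \<open>mat_s\<close> times
      \<open>h\<close>.\<close>
    have "h = mat_s ** mat2 c d (- a) (- b)"
      unfolding h mat_s_def mat2_def[symmetric] by (simp add: mat2_mult)
    moreover have "mat2 c d (- a) (- b) \<in> Gamma 2"
      using 2 det unfolding mat2_in_Gamma by (auto simp: cong_def mult.commute) presburger+
    ultimately show ?thesis by blast
  qed
qed

text \<open>Modulo 2 the theta group becomes a subgroup of order two in a group isomorphic to the
  symmetric group on three letters; these matrices represent its three right cosets.\<close>

definition theta_reps :: "(int^2^2) set" where
  "theta_reps = {mat2 1 0 0 1, mat2 1 1 0 1, mat2 1 0 1 1}"

lemma card_theta_reps: "card theta_reps = 3"
  by (simp add: theta_reps_def mat2_eq_iff)

lemma theta_reps_subset: "theta_reps \<subseteq> carrier SL2Z"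
  by (simp add: theta_reps_def)

lemma theta_reps_inequivalent:
  assumes "x \<in> theta_reps" "y \<in> theta_reps" "x ** inv\<^bsub>SL2Z\<^esub> y \<in> Gamma_theta"
  shows "x = y"
  using assms by (auto simp: theta_reps_def inv_mat2 mat2_mult in_Gamma_theta_iff)

lemma theta_reps_cover:
  assumes "x \<in> carrier SL2Z"
  shows "\<exists>r\<in>theta_reps. x ** inv\<^bsub>SL2Z\<^esub> r \<in> Gamma_theta"
proof -
  obtain a b c d where x: "x = mat2 a b c d" by (rule mat2_cases)
  have det: "a * d - b * c = 1" using assms unfolding x by simp
  then have "odd (a * d - b * c)" by simp
  then have "(odd a \<and> odd d) \<noteq> (odd b \<and> odd c)" by auto
  then show ?thesis
    using det by (auto simp: x theta_reps_def inv_mat2 mat2_mult in_Gamma_theta_iff algebra_simps)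
qed

text \<open>For each \<open>x\<close>, the arguments \<open>x ** A\<close> and \<open>x ** B\<close>
  differ by a left factor in \<open>Gamma n\<close>, on which \<open>\<rho>\<close> is trivial;
  equivariance then equates the values of \<open>f\<close>.\<close>

lemma ind_act_cong_Gamma:
  assumes ker: "Gamma n \<subseteq> rep_kernel Theta V \<rho>"
    and f: "f \<in> ind_space SL2Z Gamma_theta V \<rho>"
    and AB: "A \<in> carrier SL2Z" "B \<in> carrier SL2Z" "\<And>i j. [A $ i $ j = B $ i $ j] (mod int n)"
  shows "ind_act SL2Z A f = ind_act SL2Z B f"
proof
  interpret group SL2Z by (rule group_SL2Z)
  fix x
  show "ind_act SL2Z A f x = ind_act SL2Z B f x"
  proof (cases "x \<in> carrier SL2Z")
    case True
    define \<gamma> where "\<gamma> = x \<otimes>\<^bsub>SL2Z\<^esub> A \<otimes>\<^bsub>SL2Z\<^esub> inv\<^bsub>SL2Z\<^esub> (x \<otimes>\<^bsub>SL2Z\<^esub> B)"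
    have cl: "x ** A \<in> carrier SL2Z" "x ** B \<in> carrier SL2Z"
      using m_closed[of x A] m_closed[of x B] True AB by auto
    have "\<gamma> \<in> Gamma n"
      using mult_inv_in_Gamma[OF cl] matrix_cong_mult[of x x "int n" A B] AB(3)
      unfolding \<gamma>_def by simp
    then have \<gamma>: "\<gamma> \<in> Gamma_theta" "\<And>v. v \<in> V \<Longrightarrow> \<rho> \<gamma> v = v"
      using ker unfolding rep_kernel_def by auto
    have "x \<otimes>\<^bsub>SL2Z\<^esub> A = \<gamma> \<otimes>\<^bsub>SL2Z\<^esub> (x \<otimes>\<^bsub>SL2Z\<^esub> B)"
      unfolding \<gamma>_def using True AB by (simp add: m_assoc del: SL2Z_simps)
    moreover have "f (\<gamma> \<otimes>\<^bsub>SL2Z\<^esub> (x \<otimes>\<^bsub>SL2Z\<^esub> B)) = f (x \<otimes>\<^bsub>SL2Z\<^esub> B)"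
      using f \<gamma> True AB(2) m_closed[of x B] unfolding ind_space_def by simp
    ultimately show ?thesis using True by (simp add: ind_act_def)
  qed (simp add: ind_act_def)
qed

text \<open>The operator of \<open>A\<close> depends only on the entries of \<open>A\<close> modulo
  \<open>n\<close>, which take finitely many values. This is the finiteness that averaging
  requires.\<close>

lemma finite_ind_act_image:
  assumes "n > 0" and ker: "Gamma n \<subseteq> rep_kernel Theta V \<rho>"
  shows "finite ((\<lambda>A. restrict (ind_act SL2Z A) (ind_space SL2Z Gamma_theta V \<rho>)) ` carrier SL2Z)"
    (is "finite (?F ` _)")
proof -
  define red where
    "red A = (A$1$1 mod int n, A$1$2 mod int n, A$2$1 mod int n, A$2$2 mod int n)" for A :: "int^2^2"
  let ?I = "{0..<int n}"
  have "red ` carrier SL2Z \<subseteq> ?I \<times> ?I \<times> ?I \<times> ?I"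
    using assms(1) by (auto simp: red_def)
  then have "finite (red ` carrier SL2Z)" by (rule finite_subset) simp
  moreover have eq: "?F A = ?F B"
    if "A \<in> carrier SL2Z" "B \<in> carrier SL2Z" "red A = red B" for A B
  proof (rule restrict_ext)
    have "[A $ i $ j = B $ i $ j] (mod int n)" for i j
      using that(3) exhaust_2[of i] exhaust_2[of j] by (auto simp: red_def cong_def)
    then show "ind_act SL2Z A f = ind_act SL2Z B f" if "f \<in> ind_space SL2Z Gamma_theta V \<rho>" for f
      using ind_act_cong_Gamma[OF ker that] \<open>A \<in> carrier SL2Z\<close> \<open>B \<in> carrier SL2Z\<close> by blast
  qed
  moreover have "?F ` carrier SL2Z \<subseteq> (\<lambda>p. ?F (inv_into (carrier SL2Z) red p)) ` red ` carrier SL2Z"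
  proof
    fix T assume "T \<in> ?F ` carrier SL2Z"
    then obtain A where A: "A \<in> carrier SL2Z" "T = ?F A" by blast
    then have "T = ?F (inv_into (carrier SL2Z) red (red A))"
      using eq[of A "inv_into (carrier SL2Z) red (red A)"] inv_into_into[of "red A" red "carrier SL2Z"]
        f_inv_into_f[of "red A" red "carrier SL2Z"] by auto
    then show "T \<in> (\<lambda>p. ?F (inv_into (carrier SL2Z) red p)) ` red ` carrier SL2Z"
      using A(1) by blast
  qed
  ultimately show ?thesis by (meson finite_imageI finite_subset)
qed

theorem mainTheorem3:
  fixes smul :: "complex \<Rightarrow> 'v::ab_group_add \<Rightarrow> 'v"
    and V :: "'v set"
    and \<rho> :: "int^2^2 \<Rightarrow> 'v \<Rightarrow> 'v"
    and d :: nat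
  assumes "irreducible_rep smul Theta V \<rho>"
    and "congruence_rep V \<rho>"
    and "vector_space.dim smul V = d"
    and "\<not> extendable_rep smul V \<rho>"
  shows "((irreducible_rep (fun_scale smul) SL2Z (ind_space SL2Z Gamma_theta V \<rho>) (ind_act SL2Z) \<and>
            vector_space.dim (fun_scale smul) (ind_space SL2Z Gamma_theta V \<rho>) = 3 * d)
          \<or> sum_of_two_irreducibles (fun_scale smul) SL2Z (ind_space SL2Z Gamma_theta V \<rho>)
              (ind_act SL2Z) (3 / 2 * real d))
       \<and> (odd d \<longrightarrow>
            \<not> sum_of_two_irreducibles (fun_scale smul) SL2Z (ind_space SL2Z Gamma_theta V \<rho>)
                (ind_act SL2Z) (3 / 2 * real d))"
proof (intro conjI impI notI)
  interpret induced_rep smul SL2Z Gamma_theta V \<rho>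
    using group_SL2Z subgroup_Gamma_theta assms(1)
    by (simp add: induced_rep_def irreducible_rep_def)
  obtain n where n: "n > 0" "Gamma n \<subseteq> rep_kernel Theta V \<rho>"
    using assms(2) unfolding congruence_rep_def by blast
  have "mat_s \<in> Gamma_theta"
    unfolding mat_s_def mat2_def[symmetric] in_Gamma_theta_iff by simp
  \<comment> \<open>Here \<open>N\<close> is \<open>Gamma 2\<close>, the element \<open>s\<close> is
    \<open>mat_s\<close>, and \<open>R\<close> is \<open>theta_reps\<close>; the level
    \<open>n\<close> only serves to make the set of operators finite.\<close>
  from irreducible_or_sum_of_two_irreducibles[OF assms(1) normal_Gamma Gamma_2_subset_Gamma_theta this
      _ card_theta_reps theta_reps_subset _ _ finite_ind_act_image[OF n]]
  show "irreducible_rep (fun_scale smul) SL2Z (ind_space SL2Z Gamma_theta V \<rho>) (ind_act SL2Z) \<and>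
      vector_space.dim (fun_scale smul) (ind_space SL2Z Gamma_theta V \<rho>) = 3 * d
    \<or> sum_of_two_irreducibles (fun_scale smul) SL2Z (ind_space SL2Z Gamma_theta V \<rho>)
        (ind_act SL2Z) (3 / 2 * real d)"
    using Gamma_theta_coset_Gamma_2 theta_reps_inequivalent theta_reps_cover assms(4)
    unfolding extendable_rep_def SL2Z_simps assms(3) by blast
next
  assume "odd d" "sum_of_two_irreducibles (fun_scale smul) SL2Z (ind_space SL2Z Gamma_theta V \<rho>)
    (ind_act SL2Z) (3 / 2 * real d)"
  \<comment> \<open>\<open>k\<close> is the dimension of a summand; being a natural number, it
    forces \<open>3 * d\<close> to be even.\<close>
  then obtain k :: nat where "real k = 3 / 2 * real d"
    unfolding sum_of_two_irreducibles_def by blast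
  then have "2 * k = 3 * d" by linarith
  then show False using \<open>odd d\<close> by presburger
qed

end
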